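(* There is a polynomial-time algorithm that, given a polyomino $P$, a set $S$ of $m$ non-attacking rooks on $P$, and an integer $k>0$, decides whether there exists a set of $m+k$ non-attacking rooks on $P$ containing $S$.
   Context: A polyomino is a finite union of unit squares (tiles) of the standard grid in $\mathbb{R}^2$ with connected interior. Two tiles of $P$ are in the same row (resp. column) of $P$ if the segment joining their centers is horizontal (resp. vertical) and contained in $P$. A set of rooks on distinct tiles is non-attacking if no two of them are in the same row or in the same column of $P$. *)

theory Defs
  imports
    "HOL-Analysis.Analysis"
    "HOL-Library.Log_Nat"
    "HOL-Computational_Algebra.Polynomial"
begin

section \<open>Polyominoes and rooks\<close>

text \<open>A cell \<open>(i, j)\<close> names the unit square of the grid with lower left corner \<open>(i, j)\<close>.\<close>

type_synonym cell = "int \<times> int"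

definition square :: "cell \<Rightarrow> (real \<times> real) set" where
  "square c = {of_int (fst c) .. of_int (fst c) + 1} \<times> {of_int (snd c) .. of_int (snd c) + 1}"

definition center :: "cell \<Rightarrow> real \<times> real" where
  "center c = (of_int (fst c) + 1 / 2, of_int (snd c) + 1 / 2)"

definition polyomino :: "(real \<times> real) set \<Rightarrow> bool" where
  "polyomino P \<longleftrightarrow> (\<exists>C. finite C \<and> P = (\<Union>c\<in>C. square c)) \<and> connected (interior P)"

definition tiles :: "(real \<times> real) set \<Rightarrow> cell set" where
  "tiles P = {c. square c \<subseteq> P}"

definition same_row :: "(real \<times> real) set \<Rightarrow> cell \<Rightarrow> cell \<Rightarrow> bool" where
  "same_row P a b \<longleftrightarrow>
     snd (center a) = snd (center b) \<and> closed_segment (center a) (center b) \<subseteq> P"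

definition same_column :: "(real \<times> real) set \<Rightarrow> cell \<Rightarrow> cell \<Rightarrow> bool" where
  "same_column P a b \<longleftrightarrow>
     fst (center a) = fst (center b) \<and> closed_segment (center a) (center b) \<subseteq> P"

definition non_attacking :: "(real \<times> real) set \<Rightarrow> cell set \<Rightarrow> bool" where
  "non_attacking P S \<longleftrightarrow> S \<subseteq> tiles P \<and>
     (\<forall>a\<in>S. \<forall>b\<in>S. a \<noteq> b \<longrightarrow> \<not> same_row P a b \<and> \<not> same_column P a b)"

section \<open>Random access machines with logarithmic cost\<close>

text \<open>
  An algorithm is a structured program for a random access machine whose memory
  consists of integer registers with integer addresses; the only arithmetic is addition and
  subtraction.  Running time is measured in the logarithmic cost model: every integer that is
  produced, used as an address or stored is charged its length in binary.  Hence polynomial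
  time here is polynomial time on a Turing machine.
\<close>

datatype expr =
    Const int
  | Mem expr  \<comment> \<open>content of the register whose address is the value of the argument\<close>
  | Plus expr expr
  | Minus expr expr

datatype test =
    Less expr expr
  | Neg test
  | Conj test test

datatype prog =
    Skip
  | Store expr expr  \<comment> \<open>address, new content\<close>
  | Seq prog prog
  | Cond test prog prog
  | Loop test prog

type_synonym memory = "int \<Rightarrow> int"

text \<open>The number of binary digits of the absolute value, plus one for the sign.\<close>

definition bits :: "int \<Rightarrow> nat" where
  "bits z = Suc (floorlog 2 (nat \<bar>z\<bar>))"

fun eval :: "expr \<Rightarrow> memory \<Rightarrow> int" where
  "eval (Const n) s = n"
| "eval (Mem a) s = s (eval a s)"
| "eval (Plus a b) s = eval a s + eval b s"
| "eval (Minus a b) s = eval a s - eval b s"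

fun eval_cost :: "expr \<Rightarrow> memory \<Rightarrow> nat" where
  "eval_cost (Const n) s = bits n"
| "eval_cost (Mem a) s = eval_cost a s + bits (eval (Mem a) s)"
| "eval_cost (Plus a b) s = eval_cost a s + eval_cost b s + bits (eval (Plus a b) s)"
| "eval_cost (Minus a b) s = eval_cost a s + eval_cost b s + bits (eval (Minus a b) s)"

fun holds :: "test \<Rightarrow> memory \<Rightarrow> bool" where
  "holds (Less a b) s \<longleftrightarrow> eval a s < eval b s"
| "holds (Neg t) s \<longleftrightarrow> \<not> holds t s"
| "holds (Conj t u) s \<longleftrightarrow> holds t s \<and> holds u s"

fun test_cost :: "test \<Rightarrow> memory \<Rightarrow> nat" where
  "test_cost (Less a b) s = Suc (eval_cost a s + eval_cost b s)"
| "test_cost (Neg t) s = Suc (test_cost t s)"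
| "test_cost (Conj t u) s = Suc (test_cost t s + test_cost u s)"

text \<open>\<open>exec c s n s'\<close>: started in memory \<open>s\<close>, the program \<open>c\<close> halts at cost \<open>n\<close> in memory \<open>s'\<close>.\<close>

inductive exec :: "prog \<Rightarrow> memory \<Rightarrow> nat \<Rightarrow> memory \<Rightarrow> bool" where
  Skip: "exec Skip s 1 s"
| Store: "exec (Store a e) s (Suc (eval_cost a s + eval_cost e s)) (s(eval a s := eval e s))"
| Seq: "exec c s m s' \<Longrightarrow> exec d s' n s'' \<Longrightarrow> exec (Seq c d) s (m + n) s''"
| CondTrue: "holds t s \<Longrightarrow> exec c s n s' \<Longrightarrow> exec (Cond t c d) s (test_cost t s + n) s'"
| CondFalse: "\<not> holds t s \<Longrightarrow> exec d s n s' \<Longrightarrow> exec (Cond t c d) s (test_cost t s + n) s'"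
| LoopFalse: "\<not> holds t s \<Longrightarrow> exec (Loop t c) s (test_cost t s) s"
| LoopTrue: "holds t s \<Longrightarrow> exec c s m s' \<Longrightarrow> exec (Loop t c) s' n s'' \<Longrightarrow>
    exec (Loop t c) s (test_cost t s + m + n) s''"

lemma exec_deterministic:
  assumes "exec c s m u" and "exec c s n v"
  shows "m = n \<and> u = v"
  using assms
proof (induction arbitrary: n v rule: exec.induct)
  case Skip
  then show ?case by (auto elim: exec.cases)
next
  case Store
  then show ?case by (auto elim: exec.cases)
next
  case Seq
  from Seq.prems show ?case by cases (use Seq.IH in blast)
next
  case CondTrue
  from CondTrue.prems show ?case by cases (use CondTrue in blast)+
next
  case CondFalse
  from CondFalse.prems show ?case by cases (use CondFalse in blast)+
next
  case LoopFalse
  from LoopFalse.prems show ?case by cases (use LoopFalse in blast)+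
next
  case LoopTrue
  from LoopTrue.prems show ?case by cases (use LoopTrue in blast)+
qed

text \<open>
  The input is a list of integers, placed in the registers \<open>0, 1, \<dots>\<close>; all other
  registers are initially zero.  The answer is read from register \<open>0\<close>.
\<close>

definition input :: "int list \<Rightarrow> memory" where
  "input w a = (if 0 \<le> a \<and> a < int (length w) then w ! nat a else 0)"

definition input_size :: "int list \<Rightarrow> nat" where
  "input_size w = (\<Sum>z\<leftarrow>w. bits z)"

text \<open>
  \<open>D\<close> is the set of instances, \<open>encodes w x\<close> means that \<open>w\<close> is one of the possible
  encodings of the instance \<open>x\<close>, and \<open>Q\<close> is the property to be decided.
\<close>

definition poly_time_decidable ::
    "'a set \<Rightarrow> (int list \<Rightarrow> 'a \<Rightarrow> bool) \<Rightarrow> ('a \<Rightarrow> bool) \<Rightarrow> bool" where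
  "poly_time_decidable D encodes Q \<longleftrightarrow>
     (\<exists>(c :: prog) (p :: nat poly). \<forall>x\<in>D. \<forall>w. encodes w x \<longrightarrow>
        (\<exists>n s. exec c (input w) n s \<and> n \<le> poly p (input_size w) \<and>
               s 0 = (if Q x then 1 else 0)))"

section \<open>Encoding of instances\<close>

type_synonym rook_instance = "(real \<times> real) set \<times> cell set \<times> nat"

definition encode_cells :: "cell list \<Rightarrow> int list" where
  "encode_cells cs = int (length cs) # concat (map (\<lambda>(i, j). [i, j]) cs)"

definition encodes_rook_instance :: "int list \<Rightarrow> rook_instance \<Rightarrow> bool" where
  "encodes_rook_instance w = (\<lambda>(P, S, k).
     \<exists>ts rs. distinct ts \<and> set ts = tiles P \<and> distinct rs \<and> set rs = S \<and>
       w = encode_cells ts @ encode_cells rs @ [int k])"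

lemma center_in_square_iff: "center c \<in> square d \<longleftrightarrow> c = d"
proof
  assume "center c \<in> square d"
  then show "c = d"
    by (auto simp: center_def square_def prod_eq_iff)
next
  assume "c = d"
  then show "center c \<in> square d"
    by (auto simp: center_def square_def)
qed

lemma finite_tiles:
  assumes "polyomino P"
  shows "finite (tiles P)"
proof -
  from assms obtain C where C: "finite C" "P = (\<Union>c\<in>C. square c)"
    by (auto simp: polyomino_def)
  have "tiles P \<subseteq> C"
  proof
    fix c assume "c \<in> tiles P"
    then have "center c \<in> P"
      using center_in_square_iff[of c c] by (auto simp: tiles_def)
    then show "c \<in> C"
      using C(2) by (auto simp: center_in_square_iff)
  qed
  then show ?thesis
    using C(1) finite_subset by blast
qed

lemma rook_instance_encodable:
  assumes "polyomino P" and "non_attacking P S"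
  shows "\<exists>w. encodes_rook_instance w (P, S, k)"
proof -
  have "finite (tiles P)" "finite S"
    using assms finite_tiles finite_subset by (auto simp: non_attacking_def)
  then obtain ts rs where "distinct ts" "set ts = tiles P" "distinct rs" "set rs = S"
    using finite_distinct_list by metis
  then show ?thesis
    unfolding encodes_rook_instance_def by auto
qed

end

theory Submission
  imports Defs
begin

text \<open>
  Tiles are the edges of a bipartite graph between rows and columns, and non-attacking sets are its
  matchings.  After deleting every tile attacked by \<open>S\<close>, the question is whether a maximum matching
  has at least \<open>k\<close> edges.  A maximum matching is found by an auction: every column has an integer
  price, initially 0; as long as an unmatched row has a tile in a column of price below the number
  \<open>n\<close> of tiles, it takes the cheapest such column, evicting its owner and raising its price by one.
  At the end, at most \<open>n\<close> columns are alive, so if some price reached \<open>n\<close>, there is a price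
  \<open>g < n\<close> that no column has.  The columns above \<open>g\<close> and the matched rows whose column is below \<open>g\<close>
  then form a vertex cover of the size of the matching.

  Two tiles of a line are in the same row if and only if more tiles of that line lie between them
  (inclusively) than the distance of the two, so rows and columns are found by counting.
\<close>

section \<open>Programs with step bounds\<close>

text \<open>Under logarithmic cost, counting steps is not enough: register contents must stay short
  too. All stored values are kept within \<open>B = 2 ^ input_size w\<close>, and a fixed expression
  exceeds this bound only by a constant factor, so one test or assignment costs linearly many bits
  in the input size. It remains to count steps, and as every loop is a counting loop with
  \<open>n\<close> or \<open>m\<close> rounds, the step count is a polynomial in these. This is
  where an auction is more convenient than augmenting paths: a bid is a pass over arrays without any
  search, and attempts that find nothing to do are harmless, so a fixed number of passes replaces a
  termination test. The price cap \<open>n\<close> also makes deletion unnecessary: attacked tiles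
  stay in the arrays at price \<open>n\<close>.\<close>

fun expr_weight :: "expr \<Rightarrow> nat" where
  "expr_weight (Const n) = Suc (nat \<bar>n\<bar>)"
| "expr_weight (Mem a) = Suc (expr_weight a)"
| "expr_weight (Plus a b) = Suc (expr_weight a + expr_weight b)"
| "expr_weight (Minus a b) = Suc (expr_weight a + expr_weight b)"

fun test_weight :: "test \<Rightarrow> nat" where
  "test_weight (Less a b) = Suc (expr_weight a + expr_weight b)"
| "test_weight (Neg t) = Suc (test_weight t)"
| "test_weight (Conj t u) = Suc (test_weight t + test_weight u)"

fun prog_weight :: "prog \<Rightarrow> nat" where
  "prog_weight Skip = 1"
| "prog_weight (Store a e) = Suc (expr_weight a + expr_weight e)"
| "prog_weight (Seq c d) = prog_weight c + prog_weight d"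
| "prog_weight (Cond t c d) = test_weight t + prog_weight c + prog_weight d"
| "prog_weight (Loop t c) = test_weight t + prog_weight c"

section \<open>Bounds on values and on the cost of single steps\<close>

definition bounded_memory :: "int \<Rightarrow> memory \<Rightarrow> bool" where
  "bounded_memory B s \<longleftrightarrow> (\<forall>a. \<bar>s a\<bar> \<le> B)"

lemma bits_mono: "\<bar>x\<bar> \<le> \<bar>y\<bar> \<Longrightarrow> bits x \<le> bits y"
  by (auto simp: bits_def intro!: floorlog_mono nat_mono)

lemma one_le_bits: "1 \<le> bits x"
  by (simp add: bits_def)

text \<open>Expressions only add and subtract, so a fixed expression stretches the memory bound by a
  constant factor. The weight serves both as this factor and as a bound on the number of charged
  nodes; for the former, constants contribute their absolute value.\<close>

lemma abs_eval_le:
  assumes "bounded_memory B s" "1 \<le> B"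
  shows "\<bar>eval e s\<bar> \<le> int (expr_weight e) * B"
proof (induction e)
  case (Const n)
  have "\<bar>n\<bar> * 1 \<le> (1 + \<bar>n\<bar>) * B"
    using assms(2) by (intro mult_mono) auto
  then show ?case by simp
next
  case (Mem e)
  have "\<bar>s (eval e s)\<bar> \<le> B" using assms(1) by (simp add: bounded_memory_def)
  moreover have "0 \<le> int (expr_weight e) * B" using assms(2) by simp
  ultimately show ?case
    unfolding expr_weight.simps eval.simps of_nat_Suc distrib_right by linarith
qed (use assms(2) in \<open>auto simp: algebra_simps\<close>)

lemma bits_eval_le:
  assumes "bounded_memory B s" "1 \<le> B" "expr_weight e \<le> W"
  shows "bits (eval e s) \<le> bits (int W * B)"
proof (rule bits_mono)
  have "int (expr_weight e) * B \<le> int W * B" using assms by (intro mult_right_mono) auto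
  then show "\<bar>eval e s\<bar> \<le> \<bar>int W * B\<bar>" 
    using abs_eval_le[OF assms(1,2), of e] by linarith
qed

lemma eval_cost_le:
  assumes "bounded_memory B s" "1 \<le> B" "expr_weight e \<le> W"
  shows "eval_cost e s \<le> expr_weight e * bits (int W * B)"
  using assms(3)
proof (induction e)
  case (Const n)
  show ?case using bits_eval_le[OF assms(1,2) Const]
    by (simp add: trans_le_add1)
next
  case (Mem e)
  then show ?case using bits_eval_le[OF assms(1,2) Mem.prems] by simp
next
  case (Plus a b)
  then show ?case using bits_eval_le[OF assms(1,2) Plus.prems] by (simp add: algebra_simps)
next
  case (Minus a b)
  then show ?case using bits_eval_le[OF assms(1,2) Minus.prems] by (simp add: algebra_simps)
qed

lemma test_cost_le:
  assumes "bounded_memory B s" "1 \<le> B" "test_weight t \<le> W"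
  shows "test_cost t s \<le> test_weight t * bits (int W * B)"
  using assms(3)
proof (induction t)
  case (Less a b)
  then have "eval_cost a s \<le> expr_weight a * bits (int W * B)"
    "eval_cost b s \<le> expr_weight b * bits (int W * B)"
    using eval_cost_le[OF assms(1,2)] by auto
  then show ?case using one_le_bits[of "int W * B"] by (simp add: algebra_simps)
next
  case (Neg t)
  then show ?case using one_le_bits[of "int W * B"] by simp
next
  case (Conj t u)
  then show ?case using one_le_bits[of "int W * B"] by (simp add: algebra_simps)
qed

text \<open>Bounds the cost of a single test or assignment in a program of weight \<open>W\<close> on memory bounded by \<open>B\<close>.\<close>

definition unit_cost :: "int \<Rightarrow> nat \<Rightarrow> nat" where
  "unit_cost B W = W * bits (int W * B)"

lemma unit_cost_mono: "W \<le> W' \<Longrightarrow> 0 \<le> B \<Longrightarrow> unit_cost B W \<le> unit_cost B W'"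
  unfolding unit_cost_def by (intro mult_mono bits_mono) (auto simp: abs_mult intro: mult_right_mono)

lemma test_cost_unit:
  assumes "bounded_memory B s" "1 \<le> B" "test_weight t \<le> W"
  shows "test_cost t s \<le> unit_cost B W"
  using test_cost_le[OF assms] assms(3) by (simp add: unit_cost_def order.trans[OF _ mult_right_mono])

text \<open>A total-correctness triple. The memory bound is premise and conclusion at once, and
  \<open>T\<close> counts in units belonging to the weight of \<open>c\<close> itself, so enclosing
  \<open>c\<close> in a larger program only enlarges the unit.\<close>

definition runs :: "int \<Rightarrow> prog \<Rightarrow> memory \<Rightarrow> nat \<Rightarrow> (memory \<Rightarrow> bool) \<Rightarrow> bool" where
  "runs B c s T Q \<longleftrightarrow> (1 \<le> B \<and> bounded_memory B s \<longrightarrow>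
     (\<exists>t s'. exec c s t s' \<and> t \<le> T * unit_cost B (prog_weight c) \<and> bounded_memory B s' \<and> Q s'))"

lemma runs_mono:
  assumes "runs B c s T Q" "T \<le> T'" "\<And>s'. Q s' \<Longrightarrow> Q' s'"
  shows "runs B c s T' Q'"
  using assms unfolding runs_def by (meson mult_right_mono order.trans zero_le)

lemma runs_Skip: "Q s \<Longrightarrow> runs B Skip s (Suc T) Q"
proof -
  assume "Q s"
  moreover have "1 \<le> Suc T * unit_cost B (prog_weight Skip)"
    using one_le_bits[of B] by (simp add: unit_cost_def)
  ultimately show ?thesis
    unfolding runs_def using exec.Skip by blast
qed

text \<open>Only the new content has to respect \<open>B\<close>. The address may exceed it, since
  \<open>bounded_memory\<close> restricts contents and the cost of the address is controlled by the
  weight.\<close>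

lemma runs_Store:
  assumes "\<bar>eval e s\<bar> \<le> B" "Q (s(eval a s := eval e s))"
  shows "runs B (Store a e) s (Suc T) Q"
proof -
  have "Suc (eval_cost a s + eval_cost e s) \<le> Suc T * unit_cost B (prog_weight (Store a e))"
    if "1 \<le> B" "bounded_memory B s"
    \<comment> \<open>An assignment has the same cost and weight as the comparison of its address
      with its content.\<close>
    using test_cost_unit[OF that(2,1), of "Less a e"] by (simp add: trans_le_add1)
  moreover have "bounded_memory B (s(eval a s := eval e s))" if "bounded_memory B s"
    using that assms(1) by (simp add: bounded_memory_def)
  ultimately show ?thesis
    unfolding runs_def using exec.Store assms(2) by blast
qed

lemma runs_Seq:
  assumes "runs B c s T (\<lambda>s'. runs B d s' T' Q)"
  shows "runs B (Seq c d) s (T + T') Q"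
  unfolding runs_def
proof (intro impI, elim conjE)
  assume B: "1 \<le> B" "bounded_memory B s"
  then obtain t s' where 1: "exec c s t s'" "t \<le> T * unit_cost B (prog_weight c)"
    "bounded_memory B s'" "runs B d s' T' Q"
    using assms by (auto simp: runs_def)
  then obtain t' s'' where 2: "exec d s' t' s''" "t' \<le> T' * unit_cost B (prog_weight d)"
    "bounded_memory B s''" "Q s''"
    using B by (auto simp: runs_def)
  have "T * unit_cost B (prog_weight c) \<le> T * unit_cost B (prog_weight (Seq c d))"
    "T' * unit_cost B (prog_weight d) \<le> T' * unit_cost B (prog_weight (Seq c d))"
    using B by (auto intro!: mult_left_mono unit_cost_mono)
  then have "t + t' \<le> (T + T') * unit_cost B (prog_weight (Seq c d))"
    using 1(2) 2(2) unfolding add_mult_distrib by linarith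
  then show "\<exists>t s'. exec (Seq c d) s t s' \<and> t \<le> (T + T') * unit_cost B (prog_weight (Seq c d)) \<and>
      bounded_memory B s' \<and> Q s'"
    using exec.Seq[OF 1(1) 2(1)] 2 by blast
qed

lemma runs_Cond:
  assumes "holds t s \<Longrightarrow> runs B c s T Q" "\<not> holds t s \<Longrightarrow> runs B d s T Q"
  shows "runs B (Cond t c d) s (Suc T) Q"
  unfolding runs_def
proof (intro impI, elim conjE)
  assume B: "1 \<le> B" "bounded_memory B s"
  let ?c = "if holds t s then c else d" and ?W = "prog_weight (Cond t c d)"
  obtain u s' where 1: "exec ?c s u s'" "u \<le> T * unit_cost B (prog_weight ?c)"
    "bounded_memory B s'" "Q s'"
    using assms B by (cases "holds t s") (auto simp: runs_def)
  have "T * unit_cost B (prog_weight ?c) \<le> T * unit_cost B ?W"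
    using B by (intro mult_left_mono unit_cost_mono) auto
  moreover have "test_cost t s \<le> unit_cost B ?W"
    using B by (intro test_cost_unit) auto
  ultimately have "test_cost t s + u \<le> Suc T * unit_cost B ?W"
    using 1(2) unfolding mult_Suc by linarith
  moreover have "exec (Cond t c d) s (test_cost t s + u) s'"
    using 1(1) exec.CondTrue exec.CondFalse by (cases "holds t s") auto
  ultimately show "\<exists>u s'. exec (Cond t c d) s u s' \<and> u \<le> Suc T * unit_cost B ?W \<and>
      bounded_memory B s' \<and> Q s'"
    using 1 by blast
qed

definition For :: "int \<Rightarrow> expr \<Rightarrow> prog \<Rightarrow> prog" where
  "For v b c = Seq (Store (Const v) (Const 0))
     (Loop (Less (Mem (Const v)) b) (Seq c (Store (Const v) (Plus (Mem (Const v)) (Const 1)))))"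

text \<open>The bound \<open>b\<close> is evaluated anew in every round, so the invariant must fix
  its value. The body has to preserve the counter and to establish the invariant for the memory
  after the increment.\<close>

lemma runs_Loop_upto:
  fixes v b c
  defines "c' \<equiv> Seq c (Store (Const v) (Plus (Mem (Const v)) (Const 1)))"
  assumes bnd: "\<And>i s. i \<le> N \<Longrightarrow> I i s \<Longrightarrow> eval b s = int N \<and> s v = int i"
    and "int N \<le> B"
    and body: "\<And>i s. i < N \<Longrightarrow> I i s \<Longrightarrow>
      runs B c s K (\<lambda>s'. s' v = int i \<and> I (Suc i) (s'(v := int (Suc i))))"
    and "I i s" "i \<le> N"
  shows "runs B (Loop (Less (Mem (Const v)) b) c') s ((N - i) * (K + 2) + 1) (I N)"
  using assms(5,6)
proof (induction "N - i" arbitrary: i s)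
  case 0
  let ?t = "Less (Mem (Const v)) b"
  have "i = N" "\<not> holds ?t s" using 0 bnd[of i s] by auto
  then show ?case
    using exec.LoopFalse[of ?t s c'] test_cost_unit[of B s ?t "prog_weight (Loop ?t c')"] 0
    unfolding runs_def by fastforce
next
  case (Suc k)
  let ?t = "Less (Mem (Const v)) b"
  let ?U = "unit_cost B (prog_weight (Loop ?t c'))"
  have i: "i < N" using Suc by auto
  have t: "holds ?t s" using Suc i bnd[of i s] by auto
  show ?case
    unfolding runs_def
  proof (intro impI, elim conjE)
    assume B: "1 \<le> B" "bounded_memory B s"
    have "runs B c' s (K + 1) (I (Suc i))"
      unfolding c'_def
      by (rule runs_Seq, rule runs_mono[OF body[OF i Suc.prems(1)]], simp, simp, rule runs_Store)
        (use i \<open>int N \<le> B\<close> in \<open>auto simp: algebra_simps\<close>)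
    then obtain m s' where 1: "exec c' s m s'" "m \<le> (K + 1) * unit_cost B (prog_weight c')"
      "bounded_memory B s'" "I (Suc i) s'"
      using B by (auto simp: runs_def)
    have "runs B (Loop ?t c') s' ((N - Suc i) * (K + 2) + 1) (I N)"
      using Suc.hyps(1)[of "Suc i" s'] Suc.hyps(2) i 1(4) by simp
    then obtain n s'' where 2: "exec (Loop ?t c') s' n s''"
      "n \<le> ((N - Suc i) * (K + 2) + 1) * ?U" "bounded_memory B s''" "I N s''"
      using B 1 by (auto simp: runs_def)
    have "(K + 1) * unit_cost B (prog_weight c') \<le> (K + 1) * ?U"
      using B by (intro mult_left_mono unit_cost_mono) auto
    moreover have "test_cost ?t s \<le> ?U"
      using B by (intro test_cost_unit) auto
    ultimately have "test_cost ?t s + m + n \<le> ?U + (K + 1) * ?U + ((N - Suc i) * (K + 2) + 1) * ?U"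
      using 1(2) 2(2) by linarith
    also have "\<dots> = (Suc (N - Suc i) * (K + 2) + 1) * ?U"
      by (simp add: algebra_simps)
    also have "Suc (N - Suc i) = N - i" using i by simp
    finally show "\<exists>t s'. exec (Loop ?t c') s t s' \<and> t \<le> ((N - i) * (K + 2) + 1) * ?U \<and>
        bounded_memory B s' \<and> I N s'"
      using exec.LoopTrue[OF t 1(1) 2(1)] 2 by blast
  qed
qed

text \<open>Each round adds a test and an increment to the \<open>K\<close> steps of the body; the
  last 2 are the initialisation of the counter and the failing test.\<close>

definition loop_steps :: "nat \<Rightarrow> nat \<Rightarrow> nat" where
  "loop_steps N K = N * (K + 2) + 2"

lemma runs_For:
  assumes "I 0 (s(v := 0))"
    and "\<And>i s. i \<le> N \<Longrightarrow> I i s \<Longrightarrow> eval b s = int N \<and> s v = int i"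
    and "int N \<le> B"
    and "\<And>i s. i < N \<Longrightarrow> I i s \<Longrightarrow>
      runs B c s K (\<lambda>s'. s' v = int i \<and> I (Suc i) (s'(v := int (Suc i))))"
    and "\<And>s. I N s \<Longrightarrow> Q s"
  shows "runs B (For v b c) s (loop_steps N K) Q"
proof -
  let ?l = "Loop (Less (Mem (Const v)) b) (Seq c (Store (Const v) (Plus (Mem (Const v)) (Const 1))))"
  have "runs B ?l (s(v := 0)) (N * (K + 2) + 1) (I N)"
    using runs_Loop_upto[of N I b v B c K 0] assms by simp
  then have "runs B ?l (s(v := 0)) (N * (K + 2) + 1) Q"
    using assms(5) by (rule runs_mono[OF _ order.refl])
  then have "runs B (For v b c) s (1 + (N * (K + 2) + 1)) Q"
    unfolding For_def using assms(3) by (intro runs_Seq) (simp add: runs_Store)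
  then show ?thesis by (simp add: loop_steps_def)
qed

section \<open>Maximality of auction matchings\<close>

text \<open>\<open>owned\<close> and \<open>col\<close> cover the edges of \<open>X\<close> above
  the gap by matched columns, \<open>free\<close> and \<open>slack\<close> those below it by matched
  rows. The edges of \<open>M\<close> used by the two covers are disjoint, so the counts add up to
  at most \<open>card M\<close>.\<close>

lemma auction_matching_maximum:
  fixes p :: "'e \<Rightarrow> nat"
  assumes fin: "finite L" "card L \<le> n"
    and M: "M \<subseteq> L" "inj_on R M" "inj_on C M"
    and col: "\<And>e f. e \<in> L \<Longrightarrow> f \<in> L \<Longrightarrow> C e = C f \<Longrightarrow> p e = p f"
    and owned: "\<And>e. e \<in> L \<Longrightarrow> 0 < p e \<Longrightarrow> C e \<in> C ` M"
    and slack: "\<And>e f. e \<in> M \<Longrightarrow> f \<in> L \<Longrightarrow> R e = R f \<Longrightarrow> p e \<le> Suc (p f)"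
    and free: "\<And>e. e \<in> L \<Longrightarrow> R e \<notin> R ` M \<Longrightarrow> n \<le> p e"
    and X: "X \<subseteq> L" "inj_on R X" "inj_on C X"
  shows "card X \<le> card M"
proof (cases "\<exists>e\<in>L. R e \<notin> R ` M")
  \<comment> \<open>No price need reach \<open>n\<close> here, but the matched rows alone cover all
    edges.\<close>
  case False
  have "finite M" using fin M finite_subset by blast
  moreover have "R ` X \<subseteq> R ` M" using False X by blast
  ultimately show ?thesis
    using X M by (metis card_image card_mono finite_imageI)
next
  case True
  then obtain e0 where e0: "e0 \<in> L" "n \<le> p e0" using free by blast
  \<comment> \<open>Otherwise the \<open>n + 1\<close> different prices \<open>0, ..., n - 1\<close>
    and \<open>p e0\<close> would all occur on at most \<open>n\<close> edges.\<close>
  have "\<not> insert (p e0) {..<n} \<subseteq> p ` L"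
  proof
    assume "insert (p e0) {..<n} \<subseteq> p ` L"
    then have "card (insert (p e0) {..<n}) \<le> card L"
      using fin by (meson card_image_le card_mono finite_imageI order.trans)
    then show False using e0 fin by (simp add: card_insert_if)
  qed
  then obtain g where g: "g < n" "g \<notin> p ` L" using e0 by auto
  have finM: "finite M" and finX: "finite X" using fin M X finite_subset by blast+
  define M1 M2 X1 X2 where "M1 = {e \<in> M. g < p e}" and "M2 = {e \<in> M. p e \<le> g}"
    and "X1 = {e \<in> X. g < p e}" and "X2 = {e \<in> X. p e \<le> g}"
  note defs = M1_def M2_def X1_def X2_def
  have "C ` X1 \<subseteq> C ` M1"
  proof
    fix c assume "c \<in> C ` X1"
    then obtain e where e: "e \<in> L" "g < p e" "c = C e" using X by (auto simp: defs)
    then obtain f where f: "f \<in> M" "C e = C f" using owned[of e] by auto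
    then have "p f = p e" using col[of f e] e M by auto
    then show "c \<in> C ` M1" using e f by (auto simp: defs)
  qed
  then have "card (C ` X1) \<le> card (C ` M1)" using finM by (intro card_mono) (auto simp: defs)
  then have 1: "card X1 \<le> card M1"
    using X M by (subst (asm) (1 2) card_image) (auto simp: defs inj_on_def)
  have "R ` X2 \<subseteq> R ` M2"
  proof
    fix r assume "r \<in> R ` X2"
    then obtain e where e: "e \<in> L" "p e \<le> g" "r = R e" using X by (auto simp: defs)
    \<comment> \<open>As no edge has price \<open>g\<close>, the inequality is strict, which pays
      for the \<open>Suc\<close> in \<open>slack\<close>.\<close>
    then have "p e < g" using g by (metis imageI le_neq_implies_less)
    moreover obtain f where f: "f \<in> M" "R e = R f" using free[of e] e g by fastforce
    ultimately have "p f \<le> g" using slack[of f e] e by auto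
    then show "r \<in> R ` M2" using e f by (auto simp: defs)
  qed
  then have "card (R ` X2) \<le> card (R ` M2)" using finM by (intro card_mono) (auto simp: defs)
  then have 2: "card X2 \<le> card M2"
    using X M by (subst (asm) (1 2) card_image) (auto simp: defs inj_on_def)
  have "card X = card X1 + card X2" "card M = card M1 + card M2"
    unfolding defs using finX finM
    by (subst card_Un_disjoint[symmetric]; force intro: arg_cong[where f = card])+
  then show ?thesis using 1 2 by simp
qed

section \<open>Single bids and their invariant\<close>

definition bids :: "nat \<Rightarrow> (nat \<Rightarrow> nat) \<Rightarrow> nat set \<Rightarrow> (nat \<Rightarrow> nat) \<Rightarrow> nat \<Rightarrow> bool" where
  "bids n R M p e \<longleftrightarrow> p e < n \<and> (\<forall>f<n. R f = R e \<longrightarrow> p e \<le> p f \<and> f \<notin> M)"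

definition bid_matching :: "(nat \<Rightarrow> nat) \<Rightarrow> nat set \<Rightarrow> nat \<Rightarrow> nat set" where
  "bid_matching C M e = insert e {f \<in> M. C f \<noteq> C e}"

text \<open>The test against \<open>n\<close> matters only for dead edges in the column, which must
  stay at \<open>n\<close>: live ones share the price of the bidder, which is below
  \<open>n\<close>. Testing \<open>p f\<close> instead of \<open>p e\<close> lets the program update
  prices in place.\<close>

definition bid_price :: "nat \<Rightarrow> (nat \<Rightarrow> nat) \<Rightarrow> (nat \<Rightarrow> nat) \<Rightarrow> nat \<Rightarrow> nat \<Rightarrow> nat" where
  "bid_price n C p e f = (if C f = C e \<and> p f < n then Suc (p f) else p f)"

text \<open>Edges outside \<open>L\<close> carry the price \<open>n\<close>, at which nobody bids.\<close>

definition auction_inv ::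
    "nat \<Rightarrow> (nat \<Rightarrow> nat) \<Rightarrow> (nat \<Rightarrow> nat) \<Rightarrow> nat set \<Rightarrow> nat set \<Rightarrow> (nat \<Rightarrow> nat) \<Rightarrow> bool" where
  "auction_inv n R C L M p \<longleftrightarrow> L \<subseteq> {..<n} \<and> M \<subseteq> L \<and> inj_on R M \<and> inj_on C M \<and>
     (\<forall>e\<in>L. \<forall>f\<in>L. C e = C f \<longrightarrow> p e = p f) \<and>
     (\<forall>e\<in>L. 0 < p e \<longrightarrow> C e \<in> C ` M) \<and>
     (\<forall>e\<in>M. \<forall>f\<in>L. R e = R f \<longrightarrow> p e \<le> Suc (p f)) \<and>
     (\<forall>f<n. p f \<le> n) \<and> (\<forall>f<n. f \<notin> L \<longrightarrow> p f = n)"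

lemma auction_inv_matching:
  assumes "auction_inv n R C L M p"
  shows "L \<subseteq> {..<n}" "M \<subseteq> L" "inj_on R M" "inj_on C M"
  using assms by (simp_all add: auction_inv_def)

lemma auction_inv_init:
  "L \<subseteq> {..<n} \<Longrightarrow> auction_inv n R C L {} (\<lambda>f. if f \<in> L then 0 else n)"
  by (simp add: auction_inv_def)

text \<open>Prices never fall, so \<open>slack\<close> is endangered only where a matched edge
  becomes dearer. The only such edge is \<open>e\<close>, because other matched edges of its column
  are evicted, and \<open>e\<close> was cheapest in its row before rising by one.\<close>

lemma auction_inv_bid:
  assumes inv: "auction_inv n R C L M p" and e: "e < n" "bids n R M p e"
  shows "auction_inv n R C L (bid_matching C M e) (bid_price n C p e)"
proof -
  let ?M = "bid_matching C M e" and ?p = "bid_price n C p e"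
  note inv' = inv[unfolded auction_inv_def]
  note L = auction_inv_matching(1,2)[OF inv] and inj = auction_inv_matching(3,4)[OF inv]
  have col: "\<And>f g. f \<in> L \<Longrightarrow> g \<in> L \<Longrightarrow> C f = C g \<Longrightarrow> p f = p g" using inv' by blast
  have owned: "\<And>f. f \<in> L \<Longrightarrow> 0 < p f \<Longrightarrow> C f \<in> C ` M" using inv' by blast
  have slack: "\<And>f g. f \<in> M \<Longrightarrow> g \<in> L \<Longrightarrow> R f = R g \<Longrightarrow> p f \<le> Suc (p g)" using inv' by blast
  \<comment> \<open>Dead edges have price \<open>n\<close> and cannot bid.\<close>
  have eL: "e \<in> L" using inv' e by (metis bids_def less_irrefl)
  have row: "\<And>f. f \<in> L \<Longrightarrow> R f = R e \<Longrightarrow> p e \<le> p f \<and> f \<notin> M" "p e < n"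
    using e L by (auto simp: bids_def subset_eq)
  have price: "?p f = (if C f = C e then Suc (p e) else p f)" if "f \<in> L" for f
    using col[OF that eL] row(2) by (simp add: bid_price_def)
  have ge: "p f \<le> ?p f" for f by (simp add: bid_price_def)
  have "?M \<subseteq> L" using L eL by (auto simp: bid_matching_def)
  moreover have "inj_on R ?M"
  proof -
    have "inj_on R (M - {e})" using inj(1) by (rule inj_on_diff)
    moreover have "R e \<notin> R ` (M - {e})"
    proof
      assume "R e \<in> R ` (M - {e})"
      then obtain f where "R e = R f" "f \<in> M - {e}" by (rule imageE)
      then show False using row(1)[of f] L(2) by (simp add: subset_eq)
    qed
    ultimately have "inj_on R (insert e M)" using inj(1) by simp
    then show ?thesis by (rule inj_on_subset) (auto simp: bid_matching_def)
  qed
  moreover have "inj_on C ?M"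
    using inj(2) by (simp add: bid_matching_def inj_on_def)
  moreover have "\<forall>f\<in>L. \<forall>g\<in>L. C f = C g \<longrightarrow> ?p f = ?p g"
    using col price by metis
  moreover have "\<forall>f\<in>L. 0 < ?p f \<longrightarrow> C f \<in> C ` ?M"
  proof (intro ballI impI)
    fix f assume f: "f \<in> L" "0 < ?p f"
    show "C f \<in> C ` ?M"
    proof (cases "C f = C e")
      case True
      then show ?thesis by (auto simp: bid_matching_def)
    next
      case False
      then have "C f \<in> C ` M" using f owned[of f] price[of f] by simp
      then show ?thesis using False by (auto simp: bid_matching_def)
    qed
  qed
  moreover have "\<forall>f\<in>?M. \<forall>g\<in>L. R f = R g \<longrightarrow> ?p f \<le> Suc (?p g)"
  proof (intro ballI impI)
    fix f g assume fg: "f \<in> ?M" "g \<in> L" "R f = R g"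
    show "?p f \<le> Suc (?p g)"
    proof (cases "f = e")
      case True
      then show ?thesis using row(1)[of g] fg ge[of g] price[OF eL] by simp
    next
      case False
      then have "f \<in> M" "C f \<noteq> C e" using fg by (auto simp: bid_matching_def)
      then show ?thesis using slack[of f g] fg ge[of g] by (simp add: bid_price_def)
    qed
  qed
  moreover have "\<forall>f<n. ?p f \<le> n" "\<forall>f<n. f \<notin> L \<longrightarrow> ?p f = n"
    using inv' by (simp_all add: bid_price_def)
  ultimately show ?thesis unfolding auction_inv_def by (intro conjI L(1))
qed

lemma auction_inv_final:
  assumes inv: "auction_inv n R C L M p" and stable: "\<forall>e<n. \<not> bids n R M p e"
    and X: "X \<subseteq> L" "inj_on R X" "inj_on C X"
  shows "card X \<le> card M"
proof (rule auction_matching_maximum[of L n M R C p])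
  note inv' = inv[unfolded auction_inv_def]
  show "finite L" "card L \<le> n"
    using inv' finite_subset[of L "{..<n}"] card_mono[of "{..<n}" L] by auto
  show "M \<subseteq> L" "inj_on R M" "inj_on C M" using inv' by auto
  show "p e = p f" if "e \<in> L" "f \<in> L" "C e = C f" for e f using inv' that by blast
  show "C e \<in> C ` M" if "e \<in> L" "0 < p e" for e using inv' that by blast
  show "p e \<le> Suc (p f)" if "e \<in> M" "f \<in> L" "R e = R f" for e f using inv' that by blast
  \<comment> \<open>The cheapest edge of an unmatched row would bid if its price were below
    \<open>n\<close>.\<close>
  show "n \<le> p e" if e: "e \<in> L" "R e \<notin> R ` M" for e
  proof -
    have "e < n" using e inv' by auto
    then obtain f where f: "f < n" "R f = R e" "\<And>g. g < n \<Longrightarrow> R g = R e \<Longrightarrow> p f \<le> p g"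
      using ex_has_least_nat[of "\<lambda>f. f < n \<and> R f = R e" e p] by auto
    then have "\<not> p f < n" using stable e unfolding bids_def by (metis imageI)
    then show ?thesis using f(3)[of e] \<open>e < n\<close> by simp
  qed
qed (use X in auto)

lemma sum_price_bid:
  assumes "e < n" "p e < n"
  shows "(\<Sum>f<n. p f) < (\<Sum>f<n. bid_price n C p e f)"
  using assms by (intro sum_strict_mono_ex1) (auto simp: bid_price_def)

text \<open>No price exceeds \<open>n\<close>, so a total of \<open>n * n\<close> forces all prices
  to be \<open>n\<close>, whereas a bidder needs a smaller one.\<close>

lemma not_bids_of_sum_price:
  assumes "auction_inv n R C L M p" "n * n \<le> (\<Sum>f<n. p f)" "e < n"
  shows "\<not> bids n R M p e"
proof
  assume "bids n R M p e"
  then have "(\<Sum>f<n. p f) < (\<Sum>f<n. n)"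
    using assms by (intro sum_strict_mono_ex1) (auto simp: auction_inv_def bids_def)
  then show False using assms by simp
qed

section \<open>Rows and columns by counting\<close>

text \<open>The endpoints may come in either order; the disjunction is spelled out with negation and
  conjunction, the connectives available in tests.\<close>

definition between :: "int \<Rightarrow> int \<Rightarrow> int \<Rightarrow> bool" where
  "between a b x \<longleftrightarrow> \<not> (\<not> (a \<le> x \<and> x \<le> b) \<and> \<not> (b \<le> x \<and> x \<le> a))"

definition aligned :: "nat \<Rightarrow> (nat \<Rightarrow> int) \<Rightarrow> (nat \<Rightarrow> int) \<Rightarrow> nat \<Rightarrow> nat \<Rightarrow> bool" where
  "aligned n pos lane e f \<longleftrightarrow> lane e = lane f \<and>
     \<bar>pos e - pos f\<bar> < int (card {g. g < n \<and> lane g = lane e \<and> between (pos e) (pos f) (pos g)})"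

text \<open>Within a lane, tiles are determined by their positions, so the count is the number of
  occupied positions in an interval of \<open>\<bar>pos e - pos f\<bar> + 1\<close> integers. It
  exceeds the distance only if all of them are occupied.\<close>

lemma aligned_iff:
  assumes inj: "inj_on (\<lambda>g. (pos g, lane g)) {..<n}"
  shows "aligned n pos lane e f \<longleftrightarrow> lane e = lane f \<and>
    (\<forall>x. between (pos e) (pos f) x \<longrightarrow> (\<exists>g<n. pos g = x \<and> lane g = lane e))"
proof -
  let ?G = "{g. g < n \<and> lane g = lane e \<and> between (pos e) (pos f) (pos g)}"
  let ?I = "{min (pos e) (pos f)..max (pos e) (pos f)}"
  have bt: "between (pos e) (pos f) x \<longleftrightarrow> x \<in> ?I" for x by (auto simp: between_def)
  have "inj_on pos ?G"
  proof (rule inj_onI)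
    fix g h assume "g \<in> ?G" "h \<in> ?G" "pos g = pos h"
    then show "g = h" using inj_onD[OF inj, of g h] by simp
  qed
  then have card: "card ?G = card (pos ` ?G)" by (simp add: card_image)
  have sub: "pos ` ?G \<subseteq> ?I" using bt by auto
  have "int (card ?I) = \<bar>pos e - pos f\<bar> + 1" by auto
  then have "\<bar>pos e - pos f\<bar> < int (card ?G) \<longleftrightarrow> card ?I \<le> card (pos ` ?G)"
    using card by linarith
  also have "\<dots> \<longleftrightarrow> ?I \<subseteq> pos ` ?G"
  proof
    assume "card ?I \<le> card (pos ` ?G)"
    then have "pos ` ?G = ?I" by (intro card_seteq[OF _ sub]) auto
    then show "?I \<subseteq> pos ` ?G" by (rule equalityD2)
  next
    have "finite ?G" by (rule finite_subset[of _ "{..<n}"]) auto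
    then have "finite (pos ` ?G)" by (rule finite_imageI)
    moreover assume "?I \<subseteq> pos ` ?G"
    ultimately show "card ?I \<le> card (pos ` ?G)" by (rule card_mono)
  qed
  also have "\<dots> \<longleftrightarrow> (\<forall>x. between (pos e) (pos f) x \<longrightarrow> (\<exists>g<n. pos g = x \<and> lane g = lane e))"
  proof -
    have "x \<in> pos ` ?G \<longleftrightarrow> (\<exists>g<n. pos g = x \<and> lane g = lane e)"
      if "between (pos e) (pos f) x" for x
      using that by (simp only: image_iff mem_Collect_eq) blast
    then show ?thesis unfolding subset_eq Ball_def bt[symmetric] by blast
  qed
  finally show ?thesis by (simp add: aligned_def)
qed

text \<open>This is what a register holds after a loop that overwrites it at every index satisfying
  \<open>Q\<close>, starting from 0.\<close>

fun latest :: "(nat \<Rightarrow> bool) \<Rightarrow> nat \<Rightarrow> nat" where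
  "latest Q 0 = 0"
| "latest Q (Suc i) = (if Q i then i else latest Q i)"

lemma latest_holds: "Q f \<Longrightarrow> f < i \<Longrightarrow> Q (latest Q i) \<and> latest Q i < i"
  by (induction i) (auto simp: less_Suc_eq)

lemma latest_cong: "(\<And>f. f < i \<Longrightarrow> Q f = Q' f) \<Longrightarrow> latest Q i = latest Q' i"
  by (induction i) auto

text \<open>The largest index aligned with \<open>e\<close> names the row (or column) of \<open>e\<close>.\<close>

definition line_index :: "nat \<Rightarrow> (nat \<Rightarrow> int) \<Rightarrow> (nat \<Rightarrow> int) \<Rightarrow> nat \<Rightarrow> nat" where
  "line_index n pos lane e = latest (aligned n pos lane e) n"

text \<open>Alignment is an equivalence on the indices below \<open>n\<close>, and its largest
  member is a canonical representative of a class. For transitivity, the interval from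
  \<open>e\<close> to \<open>g\<close> is covered by those from \<open>e\<close> to \<open>f\<close>
  and from \<open>f\<close> to \<open>g\<close>.\<close>

lemma line_index_eq_iff:
  assumes inj: "inj_on (\<lambda>g. (pos g, lane g)) {..<n}" and ef: "e < n" "f < n"
  shows "line_index n pos lane e = line_index n pos lane f \<longleftrightarrow> aligned n pos lane e f"
proof
  have refl: "aligned n pos lane e e" if "e < n" for e
    using that by (auto simp: aligned_iff[OF inj] between_def)
  have sym: "aligned n pos lane f e" if "aligned n pos lane e f" for e f
    using that by (auto simp: aligned_iff[OF inj] between_def)
  have trans: "aligned n pos lane e g" if "aligned n pos lane e f" "aligned n pos lane f g" for e f g
  proof -
    have "between (pos e) (pos f) x \<or> between (pos f) (pos g) x" if "between (pos e) (pos g) x" for x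
      using that unfolding between_def by linarith
    then show ?thesis using that unfolding aligned_iff[OF inj] by metis
  qed
  have own: "aligned n pos lane e (line_index n pos lane e)" if "e < n" for e
    using latest_holds[of "aligned n pos lane e" e n] refl[OF that] that
    by (simp add: line_index_def)
  {
    assume "line_index n pos lane e = line_index n pos lane f"
    then show "aligned n pos lane e f"
      using trans[OF own[OF ef(1)]] sym[OF own[OF ef(2)]] by simp
  next
    assume "aligned n pos lane e f"
    then show "line_index n pos lane e = line_index n pos lane f"
      unfolding line_index_def
      by (intro latest_cong iffI) (blast intro: sym trans)+
  }
qed

section \<open>From the geometry of tiles to matchings\<close>

lemma tiles_Union_squares: "tiles (\<Union>c\<in>C. square c) = C"
proof
  show "tiles (\<Union>c\<in>C. square c) \<subseteq> C"
  proof
    fix c assume "c \<in> tiles (\<Union>c\<in>C. square c)"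
    then have "center c \<in> (\<Union>c\<in>C. square c)"
      using center_in_square_iff[of c c] by (auto simp: tiles_def)
    then show "c \<in> C" by (auto simp: center_in_square_iff)
  qed
qed (auto simp: tiles_def)

lemma closed_segment_Pair_same_snd:
  fixes p q h :: real
  shows "closed_segment (p, h) (q, h) = (\<lambda>x. (x, h)) ` closed_segment p q"
proof -
  have "(1 - u) *\<^sub>R (p, h) + u *\<^sub>R (q, h) = ((1 - u) *\<^sub>R p + u *\<^sub>R q, h)" for u
    by (simp add: algebra_simps)
  then show ?thesis unfolding closed_segment_def by auto
qed

text \<open>The segment passes through the center of every cell between its ends, and a center lies
  in no other square. Conversely, a point of it with abscissa \<open>u\<close> lies at half height
  in the square over \<open>\<lfloor>u\<rfloor>\<close>.\<close>

lemma same_row_iff: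
  fixes C :: "cell set"
  assumes P: "P = (\<Union>c\<in>C. square c)"
  shows "same_row P a b \<longleftrightarrow> snd a = snd b \<and> (\<forall>x. between (fst a) (fst b) x \<longrightarrow> (x, snd a) \<in> C)"
proof (cases "snd a = snd b")
  case True
  define h where "h = snd a"
  obtain x y where ab: "a = (x, h)" "b = (y, h)" using True h_def by (metis prod.collapse)
  let ?S = "closed_segment (center a) (center b)"
  have seg: "?S = (\<lambda>u. (u, of_int h + 1/2)) ` closed_segment (of_int x + 1/2) (of_int y + 1/2)"
    by (simp add: ab center_def closed_segment_Pair_same_snd)
  have "?S \<subseteq> P \<longleftrightarrow> (\<forall>z. between x y z \<longrightarrow> (z, h) \<in> C)"
  proof (intro iffI allI impI)
    fix z assume "?S \<subseteq> P" "between x y z"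
    moreover have "center (z, h) \<in> ?S"
      using \<open>between x y z\<close> unfolding seg
      by (auto simp: center_def between_def closed_segment_eq_real_ivl)
    ultimately have "center (z, h) \<in> (\<Union>c\<in>C. square c)" using P by auto
    then show "(z, h) \<in> C" by (auto simp: center_in_square_iff)
  next
    assume C: "\<forall>z. between x y z \<longrightarrow> (z, h) \<in> C"
    show "?S \<subseteq> P"
    proof
      fix v assume "v \<in> ?S"
      then obtain u where u: "v = (u, of_int h + 1/2)"
        "u \<in> closed_segment (of_int x + 1/2) (of_int y + 1/2)"
        by (auto simp: seg)
      then have "between x y \<lfloor>u\<rfloor>"
        by (auto simp: between_def closed_segment_eq_real_ivl le_floor_iff floor_le_iff split: if_splits)
      then have "(\<lfloor>u\<rfloor>, h) \<in> C" using C by blast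
      moreover have "v \<in> square (\<lfloor>u\<rfloor>, h)"
        using u by (auto simp: square_def)
      ultimately show "v \<in> P" using P by blast
    qed
  qed
  then show ?thesis using True by (simp add: same_row_def center_def ab)
qed (auto simp: same_row_def center_def)

text \<open>Reflection in the diagonal maps squares to squares and columns to rows.\<close>

lemma same_column_iff:
  fixes C :: "cell set"
  assumes P: "P = (\<Union>c\<in>C. square c)"
  shows "same_column P a b \<longleftrightarrow> fst a = fst b \<and> (\<forall>y. between (snd a) (snd b) y \<longrightarrow> (fst a, y) \<in> C)"
proof -
  let ?t = "prod.swap :: real \<times> real \<Rightarrow> real \<times> real"
  have "linear ?t" by (auto intro!: linearI simp: prod_eq_iff)
  then have seg: "?t ` closed_segment (center a) (center b) = closed_segment (center (prod.swap a)) (center (prod.swap b))"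
    using closed_segment_linear_image[of ?t "center a" "center b"] by (simp add: center_def)
  have sq: "?t ` square c = square (prod.swap c)" for c
    by (force simp: square_def)
  then have "?t ` P = (\<Union>c\<in>prod.swap ` C. square c)"
    unfolding P by (simp add: image_UN)
  note row = same_row_iff[OF this, of "prod.swap a" "prod.swap b"]
  have "?t ` closed_segment (center a) (center b) \<subseteq> ?t ` P \<longleftrightarrow> closed_segment (center a) (center b) \<subseteq> P"
    by (intro inj_image_subset_iff) (auto simp: inj_def)
  then have "same_column P a b \<longleftrightarrow> same_row (?t ` P) (prod.swap a) (prod.swap b)"
    by (simp add: same_column_def same_row_def seg) (simp add: center_def)
  then show ?thesis unfolding row by force
qed

context
  fixes P :: "(real \<times> real) set" and ts :: "cell list" and n :: nat and R C :: "nat \<Rightarrow> nat"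
  assumes P: "polyomino P" and ts: "distinct ts" "set ts = tiles P"
  defines "n \<equiv> length ts"
    and "R \<equiv> line_index n (\<lambda>i. fst (ts ! i)) (\<lambda>i. snd (ts ! i))"
    and "C \<equiv> line_index n (\<lambda>i. snd (ts ! i)) (\<lambda>i. fst (ts ! i))"
begin

lemma polyomino_eq_Union_tiles: "P = (\<Union>c\<in>tiles P. square c)"
  using P by (metis polyomino_def tiles_Union_squares)

lemma nth_tiles_iff: "c \<in> tiles P \<longleftrightarrow> (\<exists>g<n. ts ! g = c)"
  using ts by (metis in_set_conv_nth n_def)

lemma inj_nth: "inj_on ((!) ts) {..<n}"
  using ts by (auto simp: n_def inj_on_def nth_eq_iff_index_eq)

lemma same_row_iff_index: "e < n \<Longrightarrow> f < n \<Longrightarrow> same_row P (ts ! e) (ts ! f) \<longleftrightarrow> R e = R f"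
  unfolding R_def using inj_nth
  by (subst line_index_eq_iff; (subst aligned_iff)?)
    (auto simp: inj_on_def same_row_iff[OF polyomino_eq_Union_tiles] nth_tiles_iff prod_eq_iff)

lemma same_column_iff_index: "e < n \<Longrightarrow> f < n \<Longrightarrow> same_column P (ts ! e) (ts ! f) \<longleftrightarrow> C e = C f"
  unfolding C_def using inj_nth
  by (subst line_index_eq_iff; (subst aligned_iff)?)
    (auto simp: inj_on_def same_column_iff[OF polyomino_eq_Union_tiles] nth_tiles_iff prod_eq_iff)

lemma non_attacking_image_iff:
  assumes "Y \<subseteq> {..<n}"
  shows "non_attacking P ((!) ts ` Y) \<longleftrightarrow> inj_on R Y \<and> inj_on C Y"
proof -
  have Y: "e < n" if "e \<in> Y" for e using assms that by auto
  then have "(!) ts ` Y \<subseteq> tiles P" using nth_tiles_iff by blast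
  moreover have "ts ! e = ts ! f \<longleftrightarrow> e = f" if "e \<in> Y" "f \<in> Y" for e f
    using Y that inj_nth by (auto simp: inj_on_def)
  ultimately show ?thesis
    using Y by (auto simp: non_attacking_def inj_on_def same_row_iff_index same_column_iff_index)
qed

text \<open>Removing the indices of \<open>S\<close> from those of an extension leaves a matching
  inside \<open>L\<close>. Conversely, a matching in \<open>L\<close> shares no row or column with
  \<open>S\<close>, so it can be added and is disjoint from it.\<close>

lemma rook_extension_iff:
  assumes S: "non_attacking P S"
  defines "L \<equiv> {e. e < n \<and> (\<forall>r<n. ts ! r \<in> S \<longrightarrow> R e \<noteq> R r \<and> C e \<noteq> C r)}"
  shows "(\<exists>S'. S \<subseteq> S' \<and> non_attacking P S' \<and> card S' = card S + k) \<longleftrightarrow>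
    (\<exists>X\<subseteq>L. inj_on R X \<and> inj_on C X \<and> card X = k)"
proof
  have subtiles: "\<exists>Y\<subseteq>{..<n}. S = (!) ts ` Y" if "non_attacking P S" for S
  proof -
    have "S \<subseteq> (!) ts ` {..<n}"
    proof
      fix c assume "c \<in> S"
      then have "c \<in> tiles P" using that unfolding non_attacking_def by blast
      then show "c \<in> (!) ts ` {..<n}" unfolding nth_tiles_iff by blast
    qed
    then show ?thesis by (auto simp: subset_image_iff)
  qed
  obtain Y where Y: "Y \<subseteq> {..<n}" "S = (!) ts ` Y" using subtiles S by blast
  have inj_sub: "inj_on ((!) ts) Z" if "Z \<subseteq> {..<n}" for Z
    using inj_nth that inj_on_subset by blast
  have memY: "ts ! e \<in> (!) ts ` Z \<longleftrightarrow> e \<in> Z" if "e < n" "Z \<subseteq> {..<n}" for e Z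
    using inj_on_image_mem_iff[OF inj_nth] that by auto
  have L: "L = {e. e < n \<and> (\<forall>r\<in>Y. R e \<noteq> R r \<and> C e \<noteq> C r)}"
  proof -
    have "(\<forall>r<n. ts ! r \<in> S \<longrightarrow> R e \<noteq> R r \<and> C e \<noteq> C r) \<longleftrightarrow> (\<forall>r\<in>Y. R e \<noteq> R r \<and> C e \<noteq> C r)" for e
      unfolding Y(2) using memY[OF _ Y(1)] Y(1) by blast
    then show ?thesis unfolding L_def by blast
  qed
  have finY: "finite Y" using Y finite_subset by blast
  have injY: "inj_on R Y" "inj_on C Y" using S Y non_attacking_image_iff by auto
  have cardS: "card S = card Y" using Y inj_sub card_image by blast
  {
    assume "\<exists>S'. S \<subseteq> S' \<and> non_attacking P S' \<and> card S' = card S + k"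
    then obtain S' where S': "S \<subseteq> S'" "non_attacking P S'" "card S' = card S + k" by blast
    obtain Z where Z: "Z \<subseteq> {..<n}" "S' = (!) ts ` Z" using subtiles S' by blast
    have injZ: "inj_on R Z" "inj_on C Z" using S' Z non_attacking_image_iff by auto
    have "Y \<subseteq> Z"
    proof
      fix e assume "e \<in> Y"
      then have "ts ! e \<in> (!) ts ` Z" "e < n" using S'(1) Y Z(2) by blast+
      then show "e \<in> Z" using memY Z(1) by blast
    qed
    then have "card (Z - Y) = k"
      using S' cardS card_image[OF inj_sub[OF Z(1)]] Z finY by (simp add: card_Diff_subset)
    moreover have "Z - Y \<subseteq> L"
    proof
      fix e assume e: "e \<in> Z - Y"
      have "R e \<noteq> R r \<and> C e \<noteq> C r" if "r \<in> Y" for r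
        using inj_onD[OF injZ(1), of e r] inj_onD[OF injZ(2), of e r] e that \<open>Y \<subseteq> Z\<close> by blast
      then show "e \<in> L" using e Z(1) unfolding L by blast
    qed
    moreover have "inj_on R (Z - Y)" "inj_on C (Z - Y)" using injZ by (auto intro: inj_on_diff)
    ultimately show "\<exists>X\<subseteq>L. inj_on R X \<and> inj_on C X \<and> card X = k" by blast
  next
    assume "\<exists>X\<subseteq>L. inj_on R X \<and> inj_on C X \<and> card X = k"
    then obtain X where X: "X \<subseteq> L" "inj_on R X" "inj_on C X" "card X = k" by blast
    have ne: "R e \<noteq> R r" "C e \<noteq> C r" if "e \<in> X" "r \<in> Y" for e r
      using X(1) that unfolding L by blast+
    have "R ` (Y - X) \<inter> R ` (X - Y) = {}" using ne(1) by (auto simp: disjoint_iff) metis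
    moreover have "C ` (Y - X) \<inter> C ` (X - Y) = {}" using ne(2) by (auto simp: disjoint_iff) metis
    ultimately have "inj_on R (Y \<union> X)" "inj_on C (Y \<union> X)"
      using X injY unfolding inj_on_Un by blast+
    moreover have sub: "Y \<union> X \<subseteq> {..<n}" using X(1) Y(1) unfolding L by blast
    ultimately have "non_attacking P ((!) ts ` (Y \<union> X))" using non_attacking_image_iff by blast
    moreover have "card ((!) ts ` (Y \<union> X)) = card S + k"
    proof -
      have "Y \<inter> X = {}" using ne(1) by blast
      moreover have "finite X" using sub finite_subset[of X "{..<n}"] by auto
      ultimately show ?thesis
        using card_image[OF inj_sub[OF sub]] card_Un_disjoint[OF finY, of X] X cardS by simp
    qed
    moreover have "S \<subseteq> (!) ts ` (Y \<union> X)" unfolding Y(2) by (intro image_mono) simp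
    ultimately show "\<exists>S'. S \<subseteq> S' \<and> non_attacking P S' \<and> card S' = card S + k"
      by (intro exI conjI)
  }
qed

text \<open>Subsets of a matching are matchings, so all sizes up to the maximum occur.\<close>

lemma rook_extension_iff_le_card:
  assumes S: "non_attacking P S"
    and inv: "auction_inv n R C {e. e < n \<and> (\<forall>r<n. ts ! r \<in> S \<longrightarrow> R e \<noteq> R r \<and> C e \<noteq> C r)} M p"
      (is "auction_inv _ _ _ ?L _ _")
    and stable: "\<forall>e<n. \<not> bids n R M p e"
  shows "(\<exists>S'. S \<subseteq> S' \<and> non_attacking P S' \<and> card S' = card S + k) \<longleftrightarrow> k \<le> card M"
  unfolding rook_extension_iff[OF S]
proof
  assume "\<exists>X\<subseteq>?L. inj_on R X \<and> inj_on C X \<and> card X = k"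
  then obtain X where "X \<subseteq> ?L" "inj_on R X" "inj_on C X" "card X = k" by (elim exE conjE)
  then show "k \<le> card M" using auction_inv_final[OF inv stable, of X] by simp
next
  assume "k \<le> card M"
  then obtain X where X: "X \<subseteq> M" "card X = k" by (meson obtain_subset_with_card_n)
  show "\<exists>X\<subseteq>?L. inj_on R X \<and> inj_on C X \<and> card X = k"
    using X auction_inv_matching[OF inv]
    by (intro exI[of _ X] conjI) (auto intro: inj_on_subset)
qed

end

section \<open>The rook program\<close>

text \<open>Input registers have addresses \<open>\<ge> 0\<close>; working registers and arrays live at negative addresses.\<close>

definition var :: "nat \<Rightarrow> int" where
  "var j = - 1 - int j"

text \<open>Four arrays interleaved with stride 4, so that all of them can grow without a bound
  known in advance; the scalars \<open>var 0\<close> to \<open>var 15\<close> lie above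
  them.\<close>

definition arr :: "nat \<Rightarrow> int \<Rightarrow> int" where
  "arr j i = - 20 - 4 * i - int j"

lemma var_eq_iff [simp]: "var i = var j \<longleftrightarrow> i = j"
  by (simp add: var_def)

lemma arr_eq_iff [simp]: "j < 4 \<Longrightarrow> k < 4 \<Longrightarrow> arr j i = arr k i' \<longleftrightarrow> j = k \<and> i = i'"
  unfolding arr_def by presburger

lemma var_neq_arr [simp]: "j < 16 \<Longrightarrow> 0 \<le> i \<Longrightarrow> var j \<noteq> arr k i" "j < 16 \<Longrightarrow> 0 \<le> i \<Longrightarrow> arr k i \<noteq> var j"
  by (auto simp: var_def arr_def)

lemma nonneg_neq [simp]:
  "0 \<le> a \<Longrightarrow> a \<noteq> var j" "0 \<le> a \<Longrightarrow> var j \<noteq> a"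
  "0 \<le> a \<Longrightarrow> 0 \<le> i \<Longrightarrow> a \<noteq> arr k i" "0 \<le> a \<Longrightarrow> 0 \<le> i \<Longrightarrow> arr k i \<noteq> a"
  by (auto simp: var_def arr_def)

definition varE :: "nat \<Rightarrow> expr" where
  "varE j = Mem (Const (var j))"

definition arrE :: "nat \<Rightarrow> nat \<Rightarrow> expr" where
  "arrE j v = Minus (Minus (Minus (Minus (Const (- 20 - int j)) (varE v)) (varE v)) (varE v)) (varE v)"

text \<open>In the encoding, tile \<open>g\<close> occupies the registers \<open>1 + 2 * g\<close>
  and \<open>2 + 2 * g\<close>. Doubling is done by addition, as the machine cannot
  multiply.\<close>

definition coordE :: "int \<Rightarrow> nat \<Rightarrow> expr" where
  "coordE a v = Mem (Plus (Const a) (Plus (varE v) (varE v)))"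

definition rookE :: "int \<Rightarrow> expr" where
  "rookE a = Mem (Plus (varE 5) (Plus (Const a) (Plus (varE 0) (varE 0))))"

definition eqT :: "expr \<Rightarrow> expr \<Rightarrow> test" where
  "eqT a b = Conj (Neg (Less a b)) (Neg (Less b a))"

definition orT :: "test \<Rightarrow> test \<Rightarrow> test" where
  "orT t u = Neg (Conj (Neg t) (Neg u))"

definition betweenT :: "expr \<Rightarrow> expr \<Rightarrow> expr \<Rightarrow> test" where
  "betweenT a b x = orT (Conj (Neg (Less x a)) (Neg (Less b x))) (Conj (Neg (Less x b)) (Neg (Less a x)))"

lemma eval_varE [simp]: "eval (varE j) s = s (var j)"
  by (simp add: varE_def)

lemma eval_arrE [simp]: "eval (arrE j v) s = arr j (s (var v))"
  by (simp add: arrE_def arr_def)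

lemma eval_coordE [simp]: "eval (coordE a v) s = s (a + 2 * s (var v))"
  by (simp add: coordE_def)

lemma eval_rookE [simp]: "eval (rookE a) s = s (s (var 5) + a + 2 * s (var 0))"
  by (simp add: rookE_def add.assoc)

lemma holds_eqT [simp]: "holds (eqT a b) s \<longleftrightarrow> eval a s = eval b s"
  by (auto simp: eqT_def)

lemma holds_orT [simp]: "holds (orT t u) s \<longleftrightarrow> holds t s \<or> holds u s"
  by (auto simp: orT_def)

lemma holds_betweenT [simp]:
  "holds (betweenT a b x) s \<longleftrightarrow> between (eval a s) (eval b s) (eval x s)"
  by (auto simp: betweenT_def between_def)

text \<open>\<open>V\<close> and \<open>J\<close> collect the scalars and arrays that may change.
  The input is always protected; only the final answer overwrites register 0, and no frame is
  claimed for it.\<close>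

definition frame :: "nat set \<Rightarrow> nat set \<Rightarrow> memory \<Rightarrow> memory \<Rightarrow> bool" where
  "frame V J s s' \<longleftrightarrow> (\<forall>a\<ge>0. s' a = s a) \<and> (\<forall>j<16. j \<notin> V \<longrightarrow> s' (var j) = s (var j)) \<and>
     (\<forall>k<4. k \<notin> J \<longrightarrow> (\<forall>i\<ge>0. s' (arr k i) = s (arr k i)))"

lemma frame_refl: "frame V J s s"
  by (simp add: frame_def)

lemma frame_trans: "frame V J s s' \<Longrightarrow> frame V J s' s'' \<Longrightarrow> frame V J s s''"
  by (simp add: frame_def)

lemma frame_mono: "frame V J s s' \<Longrightarrow> V \<subseteq> V' \<Longrightarrow> J \<subseteq> J' \<Longrightarrow> frame V' J' s s'"
  by (auto simp: frame_def)

lemma frame_var: "frame V J s s' \<Longrightarrow> j \<in> V \<Longrightarrow> j < 16 \<Longrightarrow> frame V J s (s'(var j := x))"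
  by (auto simp: frame_def)

lemma frame_arr: "frame V J s s' \<Longrightarrow> j \<in> J \<Longrightarrow> j < 4 \<Longrightarrow> 0 \<le> i \<Longrightarrow> frame V J s (s'(arr j i := x))"
  by (auto simp: frame_def)

lemma frameD:
  assumes "frame V J s s'"
  shows "0 \<le> a \<Longrightarrow> s' a = s a" "j < 16 \<Longrightarrow> j \<notin> V \<Longrightarrow> s' (var j) = s (var j)"
    "k < 4 \<Longrightarrow> k \<notin> J \<Longrightarrow> 0 \<le> i \<Longrightarrow> s' (arr k i) = s (arr k i)"
  using assms by (auto simp: frame_def)

abbreviation "sizeE \<equiv> Mem (Const 0)"

lemma frame0: "frame V J s s' \<Longrightarrow> s' 0 = s 0"
  by (simp add: frame_def)

lemma runs_count:
  assumes "s 0 = int n" "int n \<le> B" "s (var 3) = 0"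
    and t: "\<And>g x. g < n \<Longrightarrow> holds t (s(var 3 := x, var 4 := int g)) \<longleftrightarrow> \<phi> g"
    and Q: "Q (s(var 3 := int (card {g. g < n \<and> \<phi> g}), var 4 := int n))"
  shows "runs B (For (var 4) sizeE (Cond t (Store (Const (var 3)) (Plus (varE 3) (Const 1))) Skip)) s
    (loop_steps n (Suc (Suc 0))) Q"
proof (rule runs_For[where I = "\<lambda>i s'. s' = s(var 3 := int (card {g. g < i \<and> \<phi> g}), var 4 := int i)"])
  show "s(var 4 := 0) = s(var 3 := int (card {g. g < 0 \<and> \<phi> g}), var 4 := int 0)"
    using assms(3) by auto
  fix i s'
  assume i: "i < n" and s': "s' = s(var 3 := int (card {g. g < i \<and> \<phi> g}), var 4 := int i)"
  \<comment> \<open>The counter never exceeds the number of rounds, so it stays within the memory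
    bound.\<close>
  have le: "int (card {g. g < i \<and> \<phi> g}) + 1 \<le> B"
    using card_mono[of "{..<i}" "{g. g < i \<and> \<phi> g}"] i assms(2) by fastforce
  have Suc: "{g. g < Suc i \<and> \<phi> g} = (if \<phi> i then insert i {g. g < i \<and> \<phi> g} else {g. g < i \<and> \<phi> g})"
    by (auto simp: less_Suc_eq)
  show "runs B (Cond t (Store (Const (var 3)) (Plus (varE 3) (Const 1))) Skip) s' (Suc (Suc 0))
      (\<lambda>s''. s'' (var 4) = int i \<and>
        s''(var 4 := int (Suc i)) = s(var 3 := int (card {g. g < Suc i \<and> \<phi> g}), var 4 := int (Suc i)))"
    using t[OF i] le by (intro runs_Cond runs_Store runs_Skip) (auto simp: s' Suc)
qed (use assms in auto)

text \<open>Variables 0, 1 and 4 run over \<open>e\<close>, \<open>f\<close> and the counted tiles,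
  variable 3 counts. The absolute value in \<open>aligned\<close> becomes two comparisons.
  Exchanging \<open>a\<close> and \<open>b\<close> turns rows into columns.\<close>

definition classify :: "nat \<Rightarrow> int \<Rightarrow> int \<Rightarrow> prog" where
  "classify j a b = For (var 0) sizeE (Seq (Store (arrE j 0) (Const 0))
     (For (var 1) sizeE (Seq (Store (Const (var 3)) (Const 0)) (Seq
       (For (var 4) sizeE (Cond
         (Conj (eqT (coordE b 4) (coordE b 0)) (betweenT (coordE a 0) (coordE a 1) (coordE a 4)))
         (Store (Const (var 3)) (Plus (varE 3) (Const 1))) Skip))
       (Cond (Conj (eqT (coordE b 0) (coordE b 1))
           (Conj (Less (Minus (coordE a 0) (coordE a 1)) (varE 3))
                 (Less (Minus (coordE a 1) (coordE a 0)) (varE 3))))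
         (Store (arrE j 0) (varE 1)) Skip)))))"

definition classify_steps :: "nat \<Rightarrow> nat" where
  "classify_steps n = loop_steps n (Suc 0 + loop_steps n (Suc 0 + (loop_steps n (Suc (Suc 0)) + Suc (Suc 0))))"

lemma runs_classify:
  assumes n: "s 0 = int n" "int n \<le> B" and ab: "1 \<le> a" "1 \<le> b" and j: "j < 4"
    and pos: "\<And>g. g < n \<Longrightarrow> s (a + 2 * int g) = pos g"
    and lane: "\<And>g. g < n \<Longrightarrow> s (b + 2 * int g) = lane g"
    and Q: "\<And>s'. frame {0,1,3,4} {j} s s' \<Longrightarrow>
      (\<And>e. e < n \<Longrightarrow> s' (arr j (int e)) = int (line_index n pos lane e)) \<Longrightarrow> Q s'"
  shows "runs B (classify j a b) s (classify_steps n) Q"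
proof -
  have size: "s' 0 = int n" if "frame {0,1,3,4} {j} s s'" for s'
    using frame0[OF that] n by simp
  show ?thesis
    unfolding classify_def classify_steps_def
  proof (rule runs_For[where N = n and I = "\<lambda>e s'. frame {0,1,3,4} {j} s s' \<and> s' (var 0) = int e \<and>
      (\<forall>e'<e. s' (arr j (int e')) = int (line_index n pos lane e'))"])
    show "frame {0,1,3,4} {j} s (s(var 0 := 0)) \<and> (s(var 0 := 0)) (var 0) = int 0 \<and>
      (\<forall>e'<0. (s(var 0 := 0)) (arr j (int e')) = int (line_index n pos lane e'))"
      by (simp add: frame_var frame_refl)
    fix e s1
    assume e: "e < n" and I1: "frame {0,1,3,4} {j} s s1 \<and> s1 (var 0) = int e \<and>
      (\<forall>e'<e. s1 (arr j (int e')) = int (line_index n pos lane e'))"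
    let ?A = "aligned n pos lane e"
    \<comment> \<open>Overwriting the entry of \<open>e\<close> at each aligned \<open>f\<close>
      computes \<open>latest\<close> up to the current \<open>f\<close>.\<close>
    let ?I2 = "\<lambda>f s'. frame {0,1,3,4} {j} s s' \<and> s' (var 0) = int e \<and> s' (var 1) = int f \<and>
      (\<forall>e'<e. s' (arr j (int e')) = int (line_index n pos lane e')) \<and>
      s' (arr j (int e)) = int (latest ?A f)"
    show "runs B (Seq (Store (arrE j 0) (Const 0))
       (For (var 1) sizeE (Seq (Store (Const (var 3)) (Const 0)) (Seq
         (For (var 4) sizeE (Cond
           (Conj (eqT (coordE b 4) (coordE b 0)) (betweenT (coordE a 0) (coordE a 1) (coordE a 4)))
           (Store (Const (var 3)) (Plus (varE 3) (Const 1))) Skip))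
         (Cond (Conj (eqT (coordE b 0) (coordE b 1))
             (Conj (Less (Minus (coordE a 0) (coordE a 1)) (varE 3))
                   (Less (Minus (coordE a 1) (coordE a 0)) (varE 3))))
           (Store (arrE j 0) (varE 1)) Skip))))) s1
       (Suc 0 + loop_steps n (Suc 0 + (loop_steps n (Suc (Suc 0)) + Suc (Suc 0))))
       (\<lambda>s'. s' (var 0) = int e \<and> frame {0,1,3,4} {j} s (s'(var 0 := int (Suc e))) \<and>
         (s'(var 0 := int (Suc e))) (var 0) = int (Suc e) \<and>
         (\<forall>e'<Suc e. (s'(var 0 := int (Suc e))) (arr j (int e')) = int (line_index n pos lane e')))"
    proof (rule runs_Seq, rule runs_Store, goal_cases)
      case 2
      show ?case
      proof (rule runs_For[where N = n and I = ?I2], goal_cases)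
        case 1
        then show ?case using I1 e j by (auto simp: frame_var frame_arr)
      next
        case (2 i s2)
        then show ?case using n frame0[of _ _ s s2] by auto
      next
        case (4 f s2)
        note fr = frameD[OF 4(2)[THEN conjunct1]]
        have coord: "s2 (a + 2 * int g) = pos g" "s2 (b + 2 * int g) = lane g" if "g < n" for g
          using that pos lane fr(1) ab by auto
        have s2: "s2 0 = int n" "s2 (var 0) = int e" "s2 (var 1) = int f" using 4(2) fr(1) n by auto
        let ?c = "int (card {g. g < n \<and> (lane g = lane e \<and> between (pos e) (pos f) (pos g))})"
        have holds: "?A f \<longleftrightarrow> lane e = lane f \<and> pos e - pos f < ?c \<and> pos f - pos e < ?c"
          unfolding aligned_def by auto
        show ?case
        proof (rule runs_Seq, rule runs_Store, goal_cases)
          case 2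
          show ?case
          proof (rule runs_Seq, rule runs_count[where n = n and
                \<phi> = "\<lambda>g. lane g = lane e \<and> between (pos e) (pos f) (pos g)"], goal_cases)
            case (4 g x)
            then show ?case using s2 coord ab e \<open>f < n\<close> by simp
          next
            case 5
            show ?case
              using 4 s2 coord ab e \<open>f < n\<close> j holds n
              by (intro runs_Cond runs_Store runs_Skip)
                (simp_all add: frame_var frame_arr, auto)
          qed (use s2 n in auto)
        qed (use n in auto)
      next
        case (5 s2)
        then show ?case
          using j by (auto simp: frame_var less_Suc_eq line_index_def)
      qed (use n in auto)
    qed (use n in auto)
  qed (use n Q size in auto)
qed

text \<open>Variable 5 holds the address \<open>2 n + 1\<close> of the encoded list of rooks.\<close>

definition mark :: prog where
  "mark = For (var 0) (Mem (varE 5)) (For (var 1) sizeE (For (var 2) sizeE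
     (Cond (Conj (Conj (eqT (coordE 1 1) (rookE 1)) (eqT (coordE 2 1) (rookE 2)))
         (orT (eqT (Mem (arrE 0 2)) (Mem (arrE 0 1))) (eqT (Mem (arrE 1 2)) (Mem (arrE 1 1)))))
       (Store (arrE 3 2) sizeE) Skip)))"

definition mark_steps :: "nat \<Rightarrow> nat \<Rightarrow> nat" where
  "mark_steps n m = loop_steps m (loop_steps n (loop_steps n (Suc (Suc 0))))"

text \<open>Rooks are given by coordinates, so the tile \<open>f\<close> under a rook is sought
  first and its line indices are then compared with those of \<open>e\<close>. Marking writes price
  \<open>n\<close> into the zero price array, which yields the initial prices of the
  auction.\<close>

lemma runs_mark:
  fixes R C :: "nat \<Rightarrow> nat" and xy rook :: "nat \<Rightarrow> int \<times> int"
  assumes n: "s 0 = int n" "int n \<le> B" and m: "0 \<le> s (var 5)" "s (s (var 5)) = int m" "int m \<le> B"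
    and xy: "\<And>g. g < n \<Longrightarrow> s (1 + 2 * int g) = fst (xy g)" "\<And>g. g < n \<Longrightarrow> s (2 + 2 * int g) = snd (xy g)"
    and rook: "\<And>r. r < m \<Longrightarrow> s (s (var 5) + 1 + 2 * int r) = fst (rook r)"
      "\<And>r. r < m \<Longrightarrow> s (s (var 5) + 2 + 2 * int r) = snd (rook r)"
    and R: "\<And>e. e < n \<Longrightarrow> s (arr 0 (int e)) = int (R e)"
    and C: "\<And>e. e < n \<Longrightarrow> s (arr 1 (int e)) = int (C e)"
    and price: "\<And>e. e < n \<Longrightarrow> s (arr 3 (int e)) = 0"
    and Q: "\<And>s'. frame {0,1,2} {3} s s' \<Longrightarrow>
      (\<And>e. e < n \<Longrightarrow> s' (arr 3 (int e)) =
        (if \<exists>r<m. \<exists>f<n. xy f = rook r \<and> (R e = R f \<or> C e = C f) then int n else 0)) \<Longrightarrow> Q s'"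
  shows "runs B mark s (mark_steps n m) Q"
proof -
  let ?K = "\<lambda>r f e. xy f = rook r \<and> (R e = R f \<or> C e = C f)"
  \<comment> \<open>\<open>D\<close> describes the tiles marked so far; the three nested invariants
    differ only in \<open>D\<close> and in the loop counters.\<close>
  define I where "I = (\<lambda>D s'. frame {0,1,2} {3} s s' \<and>
    (\<forall>e<n. s' (arr 3 (int e)) = (if D e then int n else 0)))"
  have I_var: "I D (s'(var j := x)) \<longleftrightarrow> I D s'" if "j \<in> {0,1,2}" for D s' j x
  proof
    assume I: "I D (s'(var j := x))"
    \<comment> \<open>Writing the old value back undoes the update, so the converse also follows
      from \<open>frame_var\<close>.\<close>
    have "frame {0,1,2} {3} s ((s'(var j := x))(var j := s' (var j)))"
      by (rule frame_var) (use I that in \<open>auto simp: I_def\<close>)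
    then show "I D s'" using I that by (auto simp: I_def)
  qed (use that in \<open>auto simp: I_def frame_var\<close>)
  have I_cong: "I D s' \<Longrightarrow> (\<And>e. e < n \<Longrightarrow> D e = D' e) \<Longrightarrow> I D' s'" for D D' s'
    by (simp add: I_def)
  have fr: "s' 0 = int n" "s' (var 5) = s (var 5)" "s' (s (var 5)) = int m" if "I D s'" for D s'
    using that n m by (auto simp: I_def frame_def)
  show ?thesis
    unfolding mark_def mark_steps_def
  proof (rule runs_For[where N = m and I = "\<lambda>r s'. s' (var 0) = int r \<and>
      I (\<lambda>e. \<exists>r'<r. \<exists>f<n. ?K r' f e) s'"], goal_cases)
    case 1
    then show ?case using price by (auto simp: I_var) (auto simp: I_def frame_refl)
  next
    case (4 r s1)
    show ?case
    proof (rule runs_For[where N = n and I = "\<lambda>f s'. s' (var 0) = int r \<and> s' (var 1) = int f \<and>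
        I (\<lambda>e. (\<exists>r'<r. \<exists>f<n. ?K r' f e) \<or> (\<exists>f'<f. ?K r f' e)) s'"], goal_cases)
      case 1
      then show ?case using 4 by (auto simp: I_var)
    next
      case (4 f s2)
      show ?case
      proof (rule runs_For[where N = n and I = "\<lambda>i s'. s' (var 0) = int r \<and> s' (var 1) = int f \<and>
          s' (var 2) = int i \<and>
          I (\<lambda>e. (\<exists>r'<r. \<exists>f<n. ?K r' f e) \<or> (\<exists>f'<f. ?K r f' e) \<or> (e < i \<and> ?K r f e)) s'"], goal_cases)
        case 1
        then show ?case using 4 by (auto simp: I_var)
      next
        case (4 e s3)
        then have e: "e < n" and s3: "s3 (var 0) = int r" "s3 (var 1) = int f" "s3 (var 2) = int e"
          and I: "I (\<lambda>i. (\<exists>r'<r. \<exists>f<n. ?K r' f i) \<or> (\<exists>f'<f. ?K r f' i) \<or> (i < e \<and> ?K r f i)) s3" (is "I ?D s3")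
          by blast+
        have F: "frame {0,1,2} {3} s s3" using I by (simp add: I_def)
        have vals: "s3 (1 + 2 * int f) = fst (xy f)" "s3 (2 + 2 * int f) = snd (xy f)"
          "s3 (s (var 5) + 1 + 2 * int r) = fst (rook r)" "s3 (s (var 5) + 2 + 2 * int r) = snd (rook r)"
          "s3 (arr 0 (int e)) = int (R e)" "s3 (arr 0 (int f)) = int (R f)"
          "s3 (arr 1 (int e)) = int (C e)" "s3 (arr 1 (int f)) = int (C f)"
          using frameD[OF F] xy rook R C m \<open>f < n\<close> \<open>r < m\<close> e by simp_all
        let ?D' = "\<lambda>i. (\<exists>r'<r. \<exists>f<n. ?K r' f i) \<or> (\<exists>f'<f. ?K r f' i) \<or> (i < Suc e \<and> ?K r f i)"
        show ?case
        proof (intro runs_Cond runs_Store runs_Skip, goal_cases)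
          case 2
          then have K: "?K r f e" using vals s3 fr[OF I] by (auto simp: prod_eq_iff)
          have "I ?D' (s3(arr 3 (int e) := int n))"
            using I K by (auto simp: I_def frame_arr less_Suc_eq)
          then show ?case using s3 fr[OF I] by (simp add: I_var)
        next
          case 3
          then have "\<not> ?K r f e" using vals s3 fr[OF I] by (auto simp: prod_eq_iff)
          then have "I ?D' s3" by (intro I_cong[OF I]) (auto simp: less_Suc_eq)
          then show ?case using s3 by (simp add: I_var)
        qed (use n fr[OF I] in auto)
      next
        case (5 s3)
        have "I (\<lambda>e. (\<exists>r'<r. \<exists>f<n. ?K r' f e) \<or> (\<exists>f'<Suc f. ?K r f' e)) s3"
          by (rule I_cong[OF 5[THEN conjunct2, THEN conjunct2, THEN conjunct2]]) (auto simp: less_Suc_eq)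
        then show ?case using 5 by (simp add: I_var)
      qed (use n fr in auto)
    next
      case (5 s2)
      have "I (\<lambda>e. \<exists>r'<Suc r. \<exists>f<n. ?K r' f e) s2"
        by (rule I_cong[OF 5[THEN conjunct2, THEN conjunct2]]) (auto simp: less_Suc_eq)
      then show ?case using 5 by (simp add: I_var)
    qed (use n fr in auto)
  next
    case (5 s1)
    then show ?case by (intro Q) (auto simp: I_def)
  qed (use m fr in auto)
qed

text \<open>Variable 2 holds the candidate and variable 3 whether it is admissible. Arrays 0 to 3
  hold row, column, membership in the matching and price. The whole column is cleared before the
  candidate enters.\<close>

definition try_bid :: prog where
  "try_bid = Seq (Store (Const (var 3)) (Const 1)) (Seq
     (For (var 4) sizeE (Cond
       (Conj (eqT (Mem (arrE 0 4)) (Mem (arrE 0 2)))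
         (orT (Less (Mem (arrE 3 4)) (Mem (arrE 3 2))) (Less (Const 0) (Mem (arrE 2 4)))))
       (Store (Const (var 3)) (Const 0)) Skip))
     (Cond (Conj (Less (Const 0) (varE 3)) (Less (Mem (arrE 3 2)) sizeE))
       (Seq
         (For (var 4) sizeE (Cond (eqT (Mem (arrE 1 4)) (Mem (arrE 1 2)))
           (Seq (Store (arrE 2 4) (Const 0))
             (Cond (Less (Mem (arrE 3 4)) sizeE) (Store (arrE 3 4) (Plus (Mem (arrE 3 4)) (Const 1))) Skip))
           Skip))
         (Store (arrE 2 2) (Const 1)))
       Skip))"

definition try_bid_steps :: "nat \<Rightarrow> nat" where
  "try_bid_steps n = Suc 0 + (loop_steps n (Suc (Suc 0)) +
     Suc (loop_steps n (Suc (Suc 0 + Suc (Suc 0))) + Suc 0))"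

definition stores :: "nat \<Rightarrow> (nat \<Rightarrow> nat) \<Rightarrow> (nat \<Rightarrow> nat) \<Rightarrow> nat set \<Rightarrow> (nat \<Rightarrow> nat) \<Rightarrow> memory \<Rightarrow> bool" where
  "stores n R C M p s \<longleftrightarrow> s 0 = int n \<and> (\<forall>f<n. s (arr 0 (int f)) = int (R f) \<and>
     s (arr 1 (int f)) = int (C f) \<and> s (arr 2 (int f)) = of_bool (f \<in> M) \<and> s (arr 3 (int f)) = int (p f))"

lemma stores_var [simp]: "j < 16 \<Longrightarrow> stores n R C M p (s(var j := x)) \<longleftrightarrow> stores n R C M p s"
  by (simp add: stores_def)

lemma runs_try_bid:
  assumes st: "stores n R C M p s" and n: "1 \<le> B" "int n \<le> B" and e: "e < n" "s (var 2) = int e"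
    and Q: "\<And>s'. frame {3,4} {2,3} s s' \<Longrightarrow>
      (if bids n R M p e then stores n R C (bid_matching C M e) (bid_price n C p e) s'
       else stores n R C M p s') \<Longrightarrow> Q s'"
  shows "runs B try_bid s (try_bid_steps n) Q"
proof -
  let ?ok = "\<lambda>f. \<not> (R f = R e \<and> (p f < p e \<or> f \<in> M))"
  let ?M = "bid_matching C M e" and ?p = "bid_price n C p e"
  have s: "s 0 = int n" "\<And>f. f < n \<Longrightarrow> s (arr 0 (int f)) = int (R f)"
    "\<And>f. f < n \<Longrightarrow> s (arr 1 (int f)) = int (C f)" "\<And>f. f < n \<Longrightarrow> s (arr 2 (int f)) = of_bool (f \<in> M)"
    "\<And>f. f < n \<Longrightarrow> s (arr 3 (int f)) = int (p f)"
    using st by (auto simp: stores_def)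
  \<comment> \<open>Entries below \<open>f\<close> are already updated; the bidder itself joins the
    matching only after the loop.\<close>
  define upd where "upd = (\<lambda>f s'. frame {3,4} {2,3} s s' \<and> s' (var 4) = int f \<and>
    (\<forall>g<n. s' (arr 2 (int g)) = of_bool (if g < f then g \<in> M \<and> C g \<noteq> C e else g \<in> M) \<and>
       s' (arr 3 (int g)) = int (if g < f then ?p g else p g)))"
  show ?thesis
    unfolding try_bid_def try_bid_steps_def
  proof (rule runs_Seq, rule runs_Store, goal_cases)
    case 2
    show ?case
    proof (rule runs_Seq, rule runs_For[where N = n and
          I = "\<lambda>f s'. s' = s(var 3 := of_bool (\<forall>g<f. ?ok g), var 4 := int f)"], goal_cases)
      case (4 f s')
      have all: "(\<forall>g<Suc f. ?ok g) \<longleftrightarrow> ?ok f \<and> (\<forall>g<f. ?ok g)" by (auto simp: less_Suc_eq)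
      show ?case
        unfolding all using 4 s e n
        by (intro runs_Cond runs_Store runs_Skip) (auto simp: fun_upd_def)
    next
      case (5 s1)
      have ok: "bids n R M p e \<longleftrightarrow> (\<forall>g<n. ?ok g) \<and> p e < n"
        by (auto simp: bids_def not_less)
      have F1: "frame {3,4} {2,3} s s1" using 5 by (simp add: frame_var frame_refl)
      have test: "holds (Conj (Less (Const 0) (varE 3)) (Less (Mem (arrE 3 2)) sizeE)) s1 \<longleftrightarrow> bids n R M p e"
        unfolding ok using 5 s e by auto
      show ?case
      proof (rule runs_Cond, goal_cases)
        case 1
        then have bid: "bids n R M p e" using test by blast
        show ?case
        proof (rule runs_Seq, rule runs_For[where N = n and I = upd], goal_cases)
          case 1
          then show ?case using 5 s unfolding upd_def by (simp add: frame_var frame_refl)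
        next
          case (2 i s2)
          then show ?case using s(1) frame0[of _ _ s s2] unfolding upd_def by auto
        next
          case (4 f s2)
          have F: "frame {3,4} {2,3} s s2" and s2: "s2 (var 4) = int f"
            and vals: "\<And>g. g < n \<Longrightarrow> s2 (arr 2 (int g)) = of_bool (if g < f then g \<in> M \<and> C g \<noteq> C e else g \<in> M)"
              "\<And>g. g < n \<Longrightarrow> s2 (arr 3 (int g)) = int (if g < f then ?p g else p g)"
            using 4(2) unfolding upd_def by auto
          have s2': "s2 0 = int n" "s2 (var 2) = int e"
            "\<And>g. g < n \<Longrightarrow> s2 (arr 1 (int g)) = int (C g)"
            using frameD[OF F] s e by auto
          have step: "upd (Suc f) (s'(var 4 := int (Suc f)))"
            if s': "frame {3,4} {2,3} s s'"
              "\<And>g. g < n \<Longrightarrow> g \<noteq> f \<Longrightarrow> s' (arr 2 (int g)) = s2 (arr 2 (int g)) \<and> s' (arr 3 (int g)) = s2 (arr 3 (int g))"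
              "s' (arr 2 (int f)) = of_bool (f \<in> M \<and> C f \<noteq> C e)" "s' (arr 3 (int f)) = int (?p f)" for s'
            unfolding upd_def
          proof (intro conjI allI impI)
            show "frame {3,4} {2,3} s (s'(var 4 := int (Suc f)))" using s'(1) by (simp add: frame_var)
            fix g assume g: "g < n"
            show "(s'(var 4 := int (Suc f))) (arr 2 (int g)) =
                of_bool (if g < Suc f then g \<in> M \<and> C g \<noteq> C e else g \<in> M)"
              "(s'(var 4 := int (Suc f))) (arr 3 (int g)) = int (if g < Suc f then ?p g else p g)"
              using g s'(2)[of g] s'(3,4) vals[of g] by (cases "g = f"; simp add: less_Suc_eq)+
          qed simp
          have f2: "s2 (arr 2 (int f)) = of_bool (f \<in> M)" "s2 (arr 3 (int f)) = int (p f)"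
            using vals[OF \<open>f < n\<close>] by auto
          show ?case
          proof (rule runs_Cond, goal_cases)
            case 1
            then have Cf: "C f = C e" using s2 s2' e \<open>f < n\<close> by simp
            show ?case
              by (intro runs_Seq runs_Cond runs_Store runs_Skip conjI step)
                (use n s2 s2' F f2 Cf \<open>f < n\<close> in \<open>auto simp: frame_arr bid_price_def\<close>)
          next
            case 2
            then have Cf: "C f \<noteq> C e" using s2 s2' e \<open>f < n\<close> by simp
            show ?case
              unfolding plus_nat.simps
              by (intro runs_Skip conjI step) (use s2 F f2 Cf in \<open>auto simp: bid_price_def\<close>)
          qed
        next
          case (5 s2)
          then have F: "frame {3,4} {2,3} s s2" and vals:
              "\<And>g. g < n \<Longrightarrow> s2 (arr 2 (int g)) = of_bool (g \<in> M \<and> C g \<noteq> C e)"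
              "\<And>g. g < n \<Longrightarrow> s2 (arr 3 (int g)) = int (?p g)"
            unfolding upd_def by auto
          have e2: "s2 (var 2) = int e" using frameD(2)[OF F, of 2] e by simp
          show ?case
          proof (rule runs_Store, goal_cases)
            case 2
            have "stores n R C ?M ?p (s2(arr 2 (int e) := 1))"
              unfolding stores_def using frameD[OF F] s vals by (auto simp: bid_matching_def)
            then show ?case using bid F by (intro Q) (simp_all add: e2 frame_arr)
          qed (use n in auto)
        qed (use n in auto)
      next
        case 2
        then have "\<not> bids n R M p e" using test by blast
        moreover have "stores n R C M p s1" using 5 st by simp
        moreover have "0 < loop_steps n (Suc (Suc 0 + Suc (Suc 0))) + Suc 0" by simp
        ultimately show ?case using Q F1 by (simp add: runs_Skip)
      qed
    qed (use n s in auto)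
  qed (use n in auto)
qed

text \<open>The two outer loops merely count \<open>n * n\<close> passes.\<close>

definition auction :: prog where
  "auction = For (var 0) sizeE (For (var 1) sizeE (For (var 2) sizeE try_bid))"

definition auction_steps :: "nat \<Rightarrow> nat" where
  "auction_steps n = loop_steps n (loop_steps n (loop_steps n (try_bid_steps n)))"

text \<open>
  Every pass of the innermost loop that is not already stable raises some price, and the prices
  sum up to at most \<open>n\<^sup>2\<close>; so \<open>n\<^sup>2\<close> passes suffice.
\<close>

lemma runs_auction:
  assumes st: "stores n R C M0 p0 s" and inv0: "auction_inv n R C L M0 p0"
    and n: "1 \<le> B" "int n \<le> B"
    and Q: "\<And>s' M p. frame {0,1,2,3,4} {2,3} s s' \<Longrightarrow> stores n R C M p s' \<Longrightarrow>
      auction_inv n R C L M p \<Longrightarrow> \<forall>e<n. \<not> bids n R M p e \<Longrightarrow> Q s'"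
  shows "runs B auction s (auction_steps n) Q"
proof -
  define I where "I = (\<lambda>\<Phi> s'. frame {0,1,2,3,4} {2,3} s s' \<and>
    (\<exists>M p. stores n R C M p s' \<and> auction_inv n R C L M p \<and> \<Phi> M p))"
  \<comment> \<open>After \<open>k\<close> passes, either nobody bids or the price total is at least
    \<open>k\<close>; the index \<open>i\<close> lets the first alternative be established edge by
    edge during a pass.\<close>
  define reached where "reached = (\<lambda>k i M p. (\<forall>e<i. \<not> bids n R M p e) \<or> k \<le> (\<Sum>f<n. p f))"
  have I_var: "I \<Phi> (s'(var j := x))" if "I \<Phi> s'" "j < 5" for \<Phi> s' j x
  proof -
    have "j \<in> {0,1,2,3,4}" using that(2) by auto
    then show ?thesis using that unfolding I_def by (auto intro: frame_var)
  qed
  have I_size: "s' 0 = int n" if "I \<Phi> s'" for \<Phi> s'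
    using that by (auto simp: I_def stores_def)
  show ?thesis
    unfolding auction_def auction_steps_def
  proof (rule runs_For[where N = n and I = "\<lambda>a s'. s' (var 0) = int a \<and> I (reached (a * n) n) s'"], goal_cases)
    case 1
    have "I (reached 0 n) s" using st inv0 by (auto simp: I_def reached_def frame_refl)
    then show ?case by (simp add: I_var)
  next
    case (4 a s1)
    show ?case
    proof (rule runs_For[where N = n and I = "\<lambda>b s'. s' (var 0) = int a \<and> s' (var 1) = int b \<and>
        I (reached (a * n + b) n) s'"], goal_cases)
      case 1
      then show ?case using 4 by (simp add: I_var)
    next
      case (4 b s2)
      let ?k = "a * n + b"
      show ?case
      proof (rule runs_For[where N = n and I = "\<lambda>e s'. s' (var 0) = int a \<and> s' (var 1) = int b \<and>
          s' (var 2) = int e \<and> I (\<lambda>M p. reached ?k n M p \<and> reached (Suc ?k) e M p) s'"], goal_cases)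
        case 1
        have "I (\<lambda>M p. reached ?k n M p \<and> reached (Suc ?k) 0 M p) s2"
          using 4 by (simp add: I_def reached_def)
        then show ?case using 4 by (simp add: I_var)
      next
        case (4 e s3)
        from 4(2) obtain M p where F: "frame {0,1,2,3,4} {2,3} s s3" and st: "stores n R C M p s3"
          and inv: "auction_inv n R C L M p" and re: "reached ?k n M p" "reached (Suc ?k) e M p"
          unfolding I_def by blast
        show ?case
        proof (rule runs_try_bid[OF st n \<open>e < n\<close>], goal_cases)
          case (2 s')
          have F': "frame {0,1,2,3,4} {2,3} s s'"
            using frame_trans[OF F frame_mono[OF 2(1)]] by auto
          have vars: "s' (var 0) = int a" "s' (var 1) = int b" "s' (var 2) = int e"
            using frameD(2)[OF 2(1)] 4 by simp_all
          have "I (\<lambda>M p. reached ?k n M p \<and> reached (Suc ?k) (Suc e) M p) s'"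
          proof (cases "bids n R M p e")
            case True
            have sum: "(\<Sum>f<n. p f) < (\<Sum>f<n. bid_price n C p e f)"
              using True \<open>e < n\<close> by (intro sum_price_bid) (auto simp: bids_def)
            \<comment> \<open>A bidder refutes the first alternative, so the total is already
              \<open>?k\<close> and the bid lifts it to \<open>Suc ?k\<close>. This also takes care
              of earlier edges that the bid enables to bid again.\<close>
            have "?k \<le> (\<Sum>f<n. p f)" using re(1) True \<open>e < n\<close> by (auto simp: reached_def)
            then have "reached ?k n M' (bid_price n C p e)" "reached (Suc ?k) (Suc e) M' (bid_price n C p e)" for M'
              using sum by (auto simp: reached_def)
            then show ?thesis
              using F' 2(2) True auction_inv_bid[OF inv \<open>e < n\<close> True] unfolding I_def by auto
          next
            case False
            then have "reached (Suc ?k) (Suc e) M p" using re(2) by (auto simp: reached_def less_Suc_eq)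
            then show ?thesis using F' 2(2) False inv re(1) unfolding I_def by auto
          qed
          then show ?case using vars by (simp add: I_var)
        qed (use 4 in auto)
      next
        case (5 s3)
        have "I (reached (a * n + Suc b) n) s3" using 5 by (auto simp: I_def)
        then show ?case using 5 by (simp add: I_var)
      qed (use n I_size in auto)
    next
      case (5 s2)
      have "I (reached (Suc a * n) n) s2" using 5 by (simp add: add.commute)
      then show ?case using 5 by (simp add: I_var)
    qed (use n I_size in auto)
  next
    case (5 s1)
    then obtain M p where F: "frame {0,1,2,3,4} {2,3} s s1" and st: "stores n R C M p s1"
      and inv: "auction_inv n R C L M p" and re: "reached (n * n) n M p"
      unfolding I_def by blast
    have "\<forall>e<n. \<not> bids n R M p e"
      using re not_bids_of_sum_price[OF inv] by (auto simp: reached_def)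
    then show ?case using Q F st inv by blast
  qed (use n I_size in auto)
qed

text \<open>Setting variable 0 to the number of rooks makes \<open>rookE 1\<close> address the register of \<open>k\<close>.\<close>

definition answer :: prog where
  "answer = Seq (Store (Const (var 3)) (Const 0)) (Seq
     (For (var 4) sizeE (Cond (Less (Const 0) (Mem (arrE 2 4)))
       (Store (Const (var 3)) (Plus (varE 3) (Const 1))) Skip))
     (Seq (Store (Const (var 0)) (Mem (varE 5)))
       (Cond (Less (varE 3) (rookE 1)) (Store (Const 0) (Const 0)) (Store (Const 0) (Const 1)))))"

definition answer_steps :: "nat \<Rightarrow> nat" where
  "answer_steps n = Suc 0 + (loop_steps n (Suc (Suc 0)) + (Suc 0 + Suc (Suc 0)))"

lemma runs_answer:
  assumes st: "stores n R C M p s" and M: "M \<subseteq> {..<n}" and n: "1 \<le> B" "int n \<le> B"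
    and m: "0 \<le> s (var 5)" "s (s (var 5)) = int m" "int m \<le> B"
    and k: "s (s (var 5) + 1 + 2 * int m) = int k"
    and Q: "\<And>s'. s' 0 = (if k \<le> card M then 1 else 0) \<Longrightarrow> Q s'"
  shows "runs B answer s (answer_steps n) Q"
proof -
  have s: "s 0 = int n" "\<And>f. f < n \<Longrightarrow> s (arr 2 (int f)) = of_bool (f \<in> M)"
    using st by (auto simp: stores_def)
  have M': "{g. g < n \<and> g \<in> M} = M" using M by auto
  have v: "s (var 5) \<noteq> var j" for j using m(1) by simp
  have v': "s (var 5) + 1 + 2 * int m \<noteq> var j" for j using m(1) by (intro nonneg_neq) simp
  show ?thesis
    unfolding answer_def answer_steps_def
  proof (rule runs_Seq, rule runs_Store, goal_cases)
    case 2
    show ?case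
    proof (rule runs_Seq, rule runs_count[where n = n and \<phi> = "\<lambda>g. g \<in> M"], goal_cases)
      case 5
      show ?case
        unfolding M'
        by (intro runs_Seq runs_Cond runs_Store) (use n m k v v' Q in auto)
    qed (use s n in auto)
  qed (use n in auto)
qed

definition rook_prog :: prog where
  "rook_prog = Seq (Store (Const (var 5)) (Plus (Plus sizeE sizeE) (Const 1)))
     (Seq (classify 0 1 2) (Seq (classify 1 2 1) (Seq mark (Seq auction answer))))"

definition rook_steps :: "nat \<Rightarrow> nat \<Rightarrow> nat" where
  "rook_steps n m = Suc 0 + (classify_steps n + (classify_steps n + (mark_steps n m + (auction_steps n + answer_steps n))))"

section \<open>Encoded inputs and polynomial bounds\<close>

lemma nth_flattened_cells:
  assumes "g < length cs"
  shows "concat (map (\<lambda>(i, j). [i, j]) cs) ! (2 * g) = fst (cs ! g)"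
    "concat (map (\<lambda>(i, j). [i, j]) cs) ! Suc (2 * g) = snd (cs ! g)"
  using assms by (induction cs arbitrary: g) (auto simp: nth_Cons' less_Suc_eq_0_disj)

lemma length_flattened_cells: "length (concat (map (\<lambda>(i, j). [i, j]) cs)) = 2 * length cs"
  by (induction cs) auto

lemma length_encode_cells: "length (encode_cells cs) = Suc (2 * length cs)"
  by (simp add: encode_cells_def length_flattened_cells)

lemma nth_encode_cells:
  "encode_cells cs ! 0 = int (length cs)"
  "g < length cs \<Longrightarrow> encode_cells cs ! Suc (2 * g) = fst (cs ! g)"
  "g < length cs \<Longrightarrow> encode_cells cs ! Suc (Suc (2 * g)) = snd (cs ! g)"
  by (simp_all add: encode_cells_def nth_flattened_cells)

lemma input_of_nat: "i < length w \<Longrightarrow> input w (int i) = w ! i"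
  by (simp add: input_def)

lemma input_neg: "a < 0 \<Longrightarrow> input w a = 0"
  by (simp add: input_def)

lemma input_encoding:
  fixes ts rs :: "cell list" and k :: nat
  defines "w \<equiv> encode_cells ts @ encode_cells rs @ [int k]"
    and "n \<equiv> length ts" and "m \<equiv> length rs"
  shows "input w 0 = int n"
    and "g < n \<Longrightarrow> input w (1 + 2 * int g) = fst (ts ! g)"
    and "g < n \<Longrightarrow> input w (2 + 2 * int g) = snd (ts ! g)"
    and "input w (2 * int n + 1) = int m"
    and "r < m \<Longrightarrow> input w (2 * int n + 1 + 1 + 2 * int r) = fst (rs ! r)"
    and "r < m \<Longrightarrow> input w (2 * int n + 1 + 2 + 2 * int r) = snd (rs ! r)"
    and "input w (2 * int n + 1 + 1 + 2 * int m) = int k"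
    and "length w = 2 * n + 2 * m + 3"
proof -
  show len: "length w = 2 * n + 2 * m + 3"
    by (simp add: w_def length_encode_cells n_def m_def)
  have inp: "input w a = w ! i" if "a = int i" "i < length w" for a i
    using that by (simp add: input_of_nat)
  have fst_part: "w ! i = encode_cells ts ! i" if "i < Suc (2 * n)" for i
    using that by (simp add: w_def nth_append length_encode_cells n_def)
  have snd_part: "w ! (Suc (2 * n) + i) = encode_cells rs ! i" if "i < Suc (2 * m)" for i
    using that by (simp add: w_def nth_append length_encode_cells n_def m_def)
  show "input w 0 = int n"
    using inp[of 0 0] fst_part[of 0] len by (simp add: nth_encode_cells n_def)
  show "input w (1 + 2 * int g) = fst (ts ! g)" if "g < n"
    using inp[of "1 + 2 * int g" "Suc (2 * g)"] fst_part[of "Suc (2 * g)"] len that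
    by (simp add: nth_encode_cells n_def)
  show "input w (2 + 2 * int g) = snd (ts ! g)" if "g < n"
    using inp[of "2 + 2 * int g" "Suc (Suc (2 * g))"] fst_part[of "Suc (Suc (2 * g))"] len that
    by (simp add: nth_encode_cells n_def)
  show "input w (2 * int n + 1) = int m"
    using inp[of "2 * int n + 1" "Suc (2 * n) + 0"] snd_part[of 0] len
    by (simp add: nth_encode_cells m_def)
  show "input w (2 * int n + 1 + 1 + 2 * int r) = fst (rs ! r)" if "r < m"
    using inp[of "2 * int n + 1 + 1 + 2 * int r" "Suc (2 * n) + Suc (2 * r)"]
      snd_part[of "Suc (2 * r)"] len that
    by (simp add: nth_encode_cells m_def)
  show "input w (2 * int n + 1 + 2 + 2 * int r) = snd (rs ! r)" if "r < m"
    using inp[of "2 * int n + 1 + 2 + 2 * int r" "Suc (2 * n) + Suc (Suc (2 * r))"]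
      snd_part[of "Suc (Suc (2 * r))"] len that
    by (simp add: nth_encode_cells m_def)
  have "w ! (Suc (2 * n) + Suc (2 * m)) = int k"
    by (simp add: w_def nth_append length_encode_cells n_def m_def)
  then show "input w (2 * int n + 1 + 1 + 2 * int m) = int k"
    using inp[of "2 * int n + 1 + 1 + 2 * int m" "Suc (2 * n) + Suc (2 * m)"] len by simp
qed

section \<open>From steps to polynomial running time\<close>

lemma length_le_input_size: "length w \<le> input_size w"
  using one_le_bits by (induction w) (auto simp: input_size_def bits_def)

text \<open>The bound is exponential in the input size, but only its number of bits enters the
  cost.\<close>

lemma bounded_input: "bounded_memory (2 ^ input_size w) (input w)"
proof -
  have "\<bar>z\<bar> \<le> 2 ^ input_size w" if "z \<in> set w" for z
  proof -
    have "bits z \<le> input_size w"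
      unfolding input_size_def using that by (intro member_le_sum_list) auto
    then have "floorlog 2 (nat \<bar>z\<bar>) \<le> input_size w" by (simp add: bits_def)
    then have "nat \<bar>z\<bar> \<le> 2 ^ input_size w"
      by (metis floorlog_leD less_imp_le one_less_numeral_iff semiring_norm(76) zero_le)
    then have "int (nat \<bar>z\<bar>) \<le> int (2 ^ input_size w)" by (simp only: of_nat_le_iff)
    then show ?thesis by simp
  qed
  then show ?thesis by (auto simp: bounded_memory_def input_def)
qed

text \<open>Since \<open>W < 2 ^ W\<close>, the product \<open>W * 2 ^ I\<close> has at most
  \<open>W + I\<close> binary digits.\<close>

lemma unit_cost_power: "unit_cost (2 ^ I) W \<le> W * (W + I + 2)"
proof -
  have "W * 2 ^ I < 2 ^ (W + I)"
    by (simp add: power_add)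
  then have "floorlog 2 (W * 2 ^ I) \<le> W + I"
    by (intro floorlog_leI) auto
  moreover have "nat \<bar>int W * 2 ^ I\<bar> = W * 2 ^ I"
    by (simp add: abs_mult nat_mult_distrib nat_power_eq)
  ultimately have "bits (int W * 2 ^ I) \<le> W + I + 2"
    by (simp add: bits_def)
  then show ?thesis unfolding unit_cost_def by (rule mult_le_mono2)
qed

lemma loop_steps_mono: "N \<le> N' \<Longrightarrow> K \<le> K' \<Longrightarrow> loop_steps N K \<le> loop_steps N' K'"
  unfolding loop_steps_def by (intro add_mono mult_mono) auto

lemma rook_steps_mono: "n \<le> I \<Longrightarrow> m \<le> I \<Longrightarrow> rook_steps n m \<le> rook_steps I I"
  unfolding rook_steps_def classify_steps_def mark_steps_def auction_steps_def
    try_bid_steps_def answer_steps_def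
  by (intro add_mono loop_steps_mono order.refl Suc_leI le_imp_less_Suc)

text \<open>Closure under sums and products spares writing out the polynomial of the nested
  loops.\<close>

definition poly_fun :: "(nat \<Rightarrow> nat) \<Rightarrow> bool" where
  "poly_fun f \<longleftrightarrow> (\<exists>p. \<forall>x. f x = poly p x)"

lemma poly_fun_const: "poly_fun (\<lambda>x. c)"
  unfolding poly_fun_def by (rule exI[of _ "[:c:]"]) simp

lemma poly_fun_id: "poly_fun (\<lambda>x. x)"
  unfolding poly_fun_def by (rule exI[of _ "[:0, 1:]"]) simp

lemma poly_fun_add: "poly_fun f \<Longrightarrow> poly_fun g \<Longrightarrow> poly_fun (\<lambda>x. f x + g x)"
  unfolding poly_fun_def by (metis poly_add)

lemma poly_fun_mult: "poly_fun f \<Longrightarrow> poly_fun g \<Longrightarrow> poly_fun (\<lambda>x. f x * g x)"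
  unfolding poly_fun_def by (metis poly_mult)

lemma poly_fun_rook_steps: "poly_fun (\<lambda>I. rook_steps I I * (W * (W + I + 2)))"
  unfolding rook_steps_def classify_steps_def mark_steps_def auction_steps_def
    try_bid_steps_def answer_steps_def loop_steps_def Suc_eq_plus1
  by (intro poly_fun_add poly_fun_mult poly_fun_const poly_fun_id)

lemma runs_rook_prog:
  fixes ts rs :: "cell list" and k :: nat
  defines "w \<equiv> encode_cells ts @ encode_cells rs @ [int k]"
  assumes P: "polyomino P" and ts: "distinct ts" "set ts = tiles P"
    and rs: "set rs = S" and S: "non_attacking P S"
  shows "runs (2 ^ input_size w) rook_prog (input w) (rook_steps (length ts) (length rs))
    (\<lambda>s. s 0 = (if \<exists>S'. S \<subseteq> S' \<and> non_attacking P S' \<and> card S' = card S + k then 1 else 0))"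
proof -
  define n m where "n = length ts" and "m = length rs"
  define R where "R = line_index n (\<lambda>i. fst (ts ! i)) (\<lambda>i. snd (ts ! i))"
  define C where "C = line_index n (\<lambda>i. snd (ts ! i)) (\<lambda>i. fst (ts ! i))"
  define L where "L = {e. e < n \<and> (\<forall>r<n. ts ! r \<in> S \<longrightarrow> R e \<noteq> R r \<and> C e \<noteq> C r)}"
  let ?B = "2 ^ input_size w :: int"
  note inp = input_encoding[where ts = ts and rs = rs and k = k, folded w_def n_def m_def]
  \<comment> \<open>Besides the input, the program stores only counters, line indices, prices, flags
    and the address \<open>2 * n + 1\<close>, all below \<open>length w\<close>.\<close>
  have "length w < 2 ^ input_size w"
    using length_le_input_size[of w] less_exp[of "input_size w"] by linarith
  then have "int (length w) < ?B" by (metis of_nat_less_iff of_nat_numeral of_nat_power)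
  then have B: "1 \<le> ?B" "int n \<le> ?B" "2 * int n + 1 \<le> ?B" "int m \<le> ?B"
    unfolding inp(8) of_nat_add of_nat_mult of_nat_numeral by linarith+
  define s0 where "s0 = (input w)(var 5 := 2 * int n + 1)"
  have s0: "s0 0 = int n" "s0 (var 5) = 2 * int n + 1" "\<And>a. 0 \<le> a \<Longrightarrow> s0 a = input w a"
    using inp(1) by (simp_all add: s0_def)
  \<comment> \<open>Registers outside the input are zero, so the empty matching and the zero prices
    need no initialisation.\<close>
  have arr0: "s0 (arr j (int i)) = 0" if "j < 4" for j i
    using that by (simp add: s0_def input_neg arr_def var_def)
  show ?thesis
    unfolding rook_prog_def rook_steps_def n_def[symmetric] m_def[symmetric]
  proof (rule runs_Seq, rule runs_Store, goal_cases)
    case 2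
    have s: "(input w)(eval (Const (var 5)) (input w) := eval (Plus (Plus sizeE sizeE) (Const 1)) (input w)) = s0"
      using inp(1) by (simp add: s0_def)
    show ?case
      unfolding s
    proof (rule runs_Seq, rule runs_classify[where pos = "\<lambda>i. fst (ts ! i)" and lane = "\<lambda>i. snd (ts ! i)"], goal_cases)
      case (8 s1)
      note F1 = frameD[OF 8(1)] and rows = 8(2)[folded R_def]
      show ?case
      proof (rule runs_Seq, rule runs_classify[where pos = "\<lambda>i. snd (ts ! i)" and lane = "\<lambda>i. fst (ts ! i)"], goal_cases)
        case (8 s2)
        note F2 = frameD[OF 8(1)] and columns = 8(2)[folded C_def]
        show ?case
        proof (rule runs_Seq, rule runs_mark[where xy = "(!) ts" and rook = "(!) rs" and R = R and C = C], goal_cases)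
          case (13 s3)
          note F3 = frameD[OF 13(1)]
          have base: "s3 a = input w a" if "0 \<le> a" for a
            using F1(1) F2(1) F3(1) s0(3) that by simp
          have v5: "s3 (var 5) = 2 * int n + 1"
            using F1(2)[of 5] F2(2)[of 5] F3(2)[of 5] s0(2) by simp
          have dead: "(\<exists>r<m. \<exists>f<n. ts ! f = rs ! r \<and> (R e = R f \<or> C e = C f)) \<longleftrightarrow> e \<notin> L" if "e < n" for e
          proof -
            have "c \<in> S \<longleftrightarrow> (\<exists>r<m. c = rs ! r)" for c
              unfolding rs[symmetric] m_def in_set_conv_nth by blast
            then show ?thesis using that unfolding L_def by blast
          qed
          have st: "stores n R C {} (\<lambda>f. if f \<in> L then 0 else n) s3"
            unfolding stores_def
          proof (intro conjI allI impI)
            show "s3 0 = int n" using base inp(1) by simp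
            fix f assume f: "f < n"
            show "s3 (arr 0 (int f)) = int (R f)"
              using rows F2(3) F3(3) f by simp
            show "s3 (arr 1 (int f)) = int (C f)"
              using columns F3(3) f by simp
            show "s3 (arr 2 (int f)) = of_bool (f \<in> {})"
              using F1(3) F2(3) F3(3) arr0 by simp
            show "s3 (arr 3 (int f)) = int (if f \<in> L then 0 else n)"
              using 13(2)[OF f] dead[OF f] by simp
          qed
          have inv: "auction_inv n R C L {} (\<lambda>f. if f \<in> L then 0 else n)"
            by (rule auction_inv_init) (auto simp: L_def)
          show ?case
          proof (rule runs_Seq, rule runs_auction[OF st inv], goal_cases)
            case (3 s4 M p)
            note F4 = frameD[OF 3(1)]
            have v5': "s4 (var 5) = 2 * int n + 1" using F4(2)[of 5] v5 by simp
            have base': "s4 a = input w a" if "0 \<le> a" for a using F4(1) base that by simp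
            have iff: "(\<exists>S'. S \<subseteq> S' \<and> non_attacking P S' \<and> card S' = card S + k) \<longleftrightarrow> k \<le> card M"
              using rook_extension_iff_le_card[OF P ts S] 3(3,4) unfolding L_def R_def C_def n_def by blast
            have "M \<subseteq> {..<n}" using auction_inv_matching(1,2)[OF 3(3)] by blast
            then show ?case
              unfolding iff
              by (rule runs_answer[OF 3(2)]) (use B inp v5' base' in auto)
          qed (use B in auto)
        qed (use B inp F1 F2 rows columns s0 arr0 in auto)
      qed (use B inp F1 s0 in auto)
    qed (use B inp s0 in auto)
  qed (use B inp in auto)
qed

theorem theorem13:
  "poly_time_decidable
     {(P, S, k). polyomino P \<and> non_attacking P S \<and> k > 0}
     encodes_rook_instance
     (\<lambda>(P, S, k). \<exists>S'. S \<subseteq> S' \<and> non_attacking P S' \<and> card S' = card S + k)"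
proof -
  let ?W = "prog_weight rook_prog"
  \<comment> \<open>Steps times the cost of a step, with both list lengths replaced by the input
    size.\<close>
  obtain p where p: "\<And>I. rook_steps I I * (?W * (?W + I + 2)) = poly p I"
    using poly_fun_rook_steps[of ?W] unfolding poly_fun_def by blast
  have "\<exists>t s. exec rook_prog (input w) t s \<and> t \<le> poly p (input_size w) \<and>
      s 0 = (if \<exists>S'. S \<subseteq> S' \<and> non_attacking P S' \<and> card S' = card S + k then 1 else 0)"
    if PS: "polyomino P" "non_attacking P S" and enc: "encodes_rook_instance w (P, S, k)" for P S k w
  proof -
    obtain ts rs where ts: "distinct ts" "set ts = tiles P" and rs: "set rs = S"
      and w: "w = encode_cells ts @ encode_cells rs @ [int k]"
      using enc by (auto simp: encodes_rook_instance_def)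
    let ?I = "input_size w" and ?B = "2 ^ input_size w :: int"
    obtain t s where ex: "exec rook_prog (input w) t s"
      and t: "t \<le> rook_steps (length ts) (length rs) * unit_cost ?B ?W"
      and s: "s 0 = (if \<exists>S'. S \<subseteq> S' \<and> non_attacking P S' \<and> card S' = card S + k then 1 else 0)"
      using runs_rook_prog[OF PS(1) ts rs PS(2), of k] bounded_input[of w]
      unfolding runs_def w[symmetric] by (auto simp del: prog_weight.simps)
    have "length ts \<le> ?I" "length rs \<le> ?I"
      using length_le_input_size[of w] by (simp_all add: w length_encode_cells)
    then have "rook_steps (length ts) (length rs) * unit_cost ?B ?W \<le> rook_steps ?I ?I * (?W * (?W + ?I + 2))"
      by (intro mult_mono rook_steps_mono unit_cost_power) auto
    then have "t \<le> poly p ?I" using t p by (metis order.trans)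
    then show ?thesis using ex s by blast
  qed
  then show ?thesis
    unfolding poly_time_decidable_def by (intro exI[of _ rook_prog] exI[of _ p]) auto
qed

end
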